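(* Let $d\geq 2$ and $n\geq 3$, let $P$ be the set of points and $H$ the set of hyperplanes of a $d$-dimensional finite projective space of order $n$, and let $A\in\{\pm1\}^{P\times H}$ be given by $A_{p,h}=1$ if $p\in h$ and $A_{p,h}=-1$ otherwise. Then $A$ is an $N\times N$ matrix with $N=N_{n,d}:=n^d+n^{d-1}+\dots+n+1=\frac{n^{d+1}-1}{n-1}$, its VC dimension is $d$, and its sign rank is larger than $$\frac{n^d-1}{n^{\frac{d-1}{2}}(n-1)}\geq N^{\frac12-\frac{1}{2d}}.$$
   Context: The sign rank of a $\pm1$ matrix $S$ is $\min\{\text{rank}(M): \text{sign}(M)=S\}$ over real matrices $M$ with no zero entries ($\text{sign}$ entrywise, rank over $\mathbb R$). A set $C$ of columns is shattered if every pattern in $\{\pm1\}^C$ appears as a row of the restriction to $C$; the VC dimension is the maximum size of a shattered set. *)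

theory Defs
  imports "HOL-Analysis.Analysis"
begin

text \<open>Projective spaces in the sense of Veblen and Young. Points are the elements of a
  finite type and lines are sets of points, so that non-Desarguesian planes are included.\<close>

locale projective_space =
  fixes lines :: "'p::finite set set"
  assumes line_unique: "p \<noteq> q \<Longrightarrow> \<exists>!l. l \<in> lines \<and> p \<in> l \<and> q \<in> l"
    and veblen_young:
      "\<lbrakk>distinct [a, b, c, d];
        ab \<in> lines; a \<in> ab; b \<in> ab; cd \<in> lines; c \<in> cd; d \<in> cd; ab \<inter> cd \<noteq> {};
        ac \<in> lines; a \<in> ac; c \<in> ac; bd \<in> lines; b \<in> bd; d \<in> bd\<rbrakk>
       \<Longrightarrow> ac \<inter> bd \<noteq> {}"
    and three_points: "l \<in> lines \<Longrightarrow> card l \<ge> 3"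

definition has_order :: "'p::finite set set \<Rightarrow> nat \<Rightarrow> bool" where
  "has_order lines n \<longleftrightarrow> (\<forall>l\<in>lines. card l = n + 1)"

definition proj_subspace :: "'p set set \<Rightarrow> 'p set \<Rightarrow> bool" where
  "proj_subspace lines X \<longleftrightarrow>
     (\<forall>l\<in>lines. \<forall>x\<in>X \<inter> l. \<forall>y\<in>X \<inter> l. x \<noteq> y \<longrightarrow> l \<subseteq> X)"

definition proj_span :: "'p set set \<Rightarrow> 'p set \<Rightarrow> 'p set" where
  "proj_span lines S = \<Inter>{X. proj_subspace lines X \<and> S \<subseteq> X}"

definition proj_independent :: "'p set set \<Rightarrow> 'p set \<Rightarrow> bool" where
  "proj_independent lines B \<longleftrightarrow> (\<forall>x\<in>B. x \<notin> proj_span lines (B - {x}))"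

text \<open>A subspace has dimension \<open>k\<close> if it has a basis of \<open>k + 1\<close> points (all bases have
  the same size by the exchange property).\<close>

definition has_proj_dim :: "'p::finite set set \<Rightarrow> 'p set \<Rightarrow> nat \<Rightarrow> bool" where
  "has_proj_dim lines X k \<longleftrightarrow>
     (\<exists>B. proj_independent lines B \<and> proj_span lines B = X \<and> card B = k + 1)"

definition hyperplanes :: "'p::finite set set \<Rightarrow> nat \<Rightarrow> 'p set set" where
  "hyperplanes lines d = {X. proj_subspace lines X \<and> has_proj_dim lines X (d - 1)}"

text \<open>Rows are indexed by points; columns by a finite type \<open>'h\<close> naming the hyperplanes,
  with \<open>hyp h\<close> the point set of the hyperplane named \<open>h\<close>.\<close>

definition signed_incidence :: "('h::finite \<Rightarrow> 'p::finite set) \<Rightarrow> real^'h^'p" where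
  "signed_incidence hyp = (\<chi> p h. if p \<in> hyp h then 1 else -1)"

definition sign_rank :: "real^'c::finite^'r::finite \<Rightarrow> nat" where
  "sign_rank S = (LEAST k. \<exists>M :: real^'c^'r.
     (\<forall>i j. M $ i $ j \<noteq> 0) \<and> (\<forall>i j. sgn (M $ i $ j) = S $ i $ j) \<and> rank M = k)"

definition shattered :: "real^'c::finite^'r::finite \<Rightarrow> 'c set \<Rightarrow> bool" where
  "shattered S C \<longleftrightarrow>
     (\<forall>f. (\<forall>j\<in>C. f j \<in> {-1, 1}) \<longrightarrow> (\<exists>i. \<forall>j\<in>C. S $ i $ j = f j))"

definition vc_dim :: "real^'c::finite^'r::finite \<Rightarrow> nat" where
  "vc_dim S = Max {card C | C. shattered S C}"

end

theory Submission
  imports Defs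
begin

text \<open>Joining a point to a subspace multiplies its number of points by \<open>n\<close> and adds one, so every
  subspace has \<open>1 + n + \<dots> + n\<^sup>r\<^sup>-\<^sup>1\<close> points for some \<open>r\<close>, and its dimension can be read off its
  cardinality. Double counting then yields the number of hyperplanes through a given subspace.
  Intersecting shattered hyperplanes one at a time drops the dimension, whence the VC dimension is
  at most \<open>d\<close>; the hyperplanes opposite to \<open>d\<close> of the \<open>d + 1\<close> points of a basis are shattered.

  For the sign rank, realise the signs as \<open>\<langle>x\<^sub>p, y\<^sub>h\<rangle>\<close> with vectors in a \<open>k\<close>-dimensional space.
  By Forster's argument a linear change of coordinates makes the normalised \<open>x\<^sub>p\<close> nearly isotropic,
  so \<open>\<Sum>p. \<bar>\<langle>x\<^sub>p, y\<^sub>h\<rangle>\<bar> \<ge> \<Sum>p. \<langle>x\<^sub>p, y\<^sub>h\<rangle>\<^sup>2\<close> is nearly at least \<open>N / k\<close>. Pairing this with the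
  incidence matrix shifted by a constant \<open>\<theta>\<close> near the density of the incidences, whose operator
  norm is at most \<open>n\<^bsup>(d-1)/2\<^esup>\<close>, bounds \<open>k\<close> from below.\<close>

section \<open>Veblen--Young geometry\<close>

lemma proj_subspace_empty: "proj_subspace lines {}"
  and proj_subspace_singleton: "proj_subspace lines {p}"
  and proj_subspace_UNIV: "proj_subspace lines UNIV"
  by (auto simp: proj_subspace_def)

lemma proj_subspaceD:
  "\<lbrakk>proj_subspace lines X; l \<in> lines; x \<in> X; y \<in> X; x \<in> l; y \<in> l; x \<noteq> y\<rbrakk> \<Longrightarrow> l \<subseteq> X"
  unfolding proj_subspace_def by blast

lemma proj_subspace_Inter:
  "(\<And>X. X \<in> F \<Longrightarrow> proj_subspace lines X) \<Longrightarrow> proj_subspace lines (\<Inter>F)"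
  unfolding proj_subspace_def by blast

lemma proj_subspace_span: "proj_subspace lines (proj_span lines S)"
  unfolding proj_span_def by (rule proj_subspace_Inter) auto

lemma proj_span_superset: "S \<subseteq> proj_span lines S"
  unfolding proj_span_def by auto

lemma proj_span_minimal: "\<lbrakk>proj_subspace lines X; S \<subseteq> X\<rbrakk> \<Longrightarrow> proj_span lines S \<subseteq> X"
  unfolding proj_span_def by auto

lemma proj_span_mono: "S \<subseteq> T \<Longrightarrow> proj_span lines S \<subseteq> proj_span lines T"
  unfolding proj_span_def by auto

lemma proj_span_subset_iff: "proj_subspace lines X \<Longrightarrow> proj_span lines S \<subseteq> X \<longleftrightarrow> S \<subseteq> X"
  using proj_span_superset[of S lines] proj_span_minimal[of lines X S] by blast

lemma proj_span_subspace: "proj_subspace lines X \<Longrightarrow> proj_span lines X = X"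
  by (simp add: proj_span_minimal proj_span_superset subset_antisym)

lemma proj_span_insert_span:
  "proj_span lines (insert p (proj_span lines S)) = proj_span lines (insert p S)"
proof
  show "proj_span lines (insert p (proj_span lines S)) \<subseteq> proj_span lines (insert p S)"
    using proj_span_superset[of "insert p S" lines] proj_span_mono[of S "insert p S" lines]
    by (intro proj_span_minimal proj_subspace_span) auto
  show "proj_span lines (insert p S) \<subseteq> proj_span lines (insert p (proj_span lines S))"
    using proj_span_superset[of S lines] by (intro proj_span_mono) auto
qed

lemma proj_span_insert_absorb:
  "p \<in> proj_span lines S \<Longrightarrow> proj_span lines (insert p S) = proj_span lines S"
  by (metis insert_absorb proj_span_insert_span proj_span_subspace proj_subspace_span)

lemma proj_independent_subset:
  assumes "proj_independent lines B" "C \<subseteq> B"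
  shows "proj_independent lines C"
  using assms proj_span_mono[of "C - {x}" "B - {x}" lines for x]
  unfolding proj_independent_def by (metis Diff_mono order_refl subsetD)

context projective_space
begin

definition line :: "'p \<Rightarrow> 'p \<Rightarrow> 'p set" where
  "line p q = (THE l. l \<in> lines \<and> p \<in> l \<and> q \<in> l)"

lemma
  assumes "p \<noteq> q"
  shows line_in_lines: "line p q \<in> lines"
    and left_in_line: "p \<in> line p q"
    and right_in_line: "q \<in> line p q"
  using theI'[OF line_unique[OF assms]] unfolding line_def by auto

lemma line_commute: "line p q = line q p"
  by (simp add: line_def conj_commute)

lemma line_eqI: "\<lbrakk>p \<noteq> q; l \<in> lines; p \<in> l; q \<in> l\<rbrakk> \<Longrightarrow> line p q = l"
  using line_unique[of p q] line_in_lines left_in_line right_in_line by blast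

lemma line_cong: "\<lbrakk>p \<noteq> q; r \<in> line p q; r \<noteq> p\<rbrakk> \<Longrightarrow> line p r = line p q"
  by (simp add: line_eqI line_in_lines left_in_line)

lemma line_subset_subspace:
  "\<lbrakk>proj_subspace lines X; p \<in> X; q \<in> X; p \<noteq> q\<rbrakk> \<Longrightarrow> line p q \<subseteq> X"
  by (meson left_in_line line_in_lines proj_subspaceD right_in_line)

lemma line_meets_subspace_once:
  assumes "proj_subspace lines X" "p \<notin> X" "q \<in> X" "q' \<in> X" "q' \<in> line p q"
  shows "q' = q"
proof (rule ccontr)
  assume "q' \<noteq> q"
  moreover have "p \<noteq> q" using assms by auto
  ultimately have "line p q \<subseteq> X"
    using assms by (intro proj_subspaceD[of lines X _ q q'] line_in_lines right_in_line) auto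
  then show False using assms left_in_line[OF \<open>p \<noteq> q\<close>] by auto
qed

lemma veblen_young_line:
  assumes "distinct [a, b, c, d]" "line a b \<inter> line c d \<noteq> {}"
  shows "line a c \<inter> line b d \<noteq> {}"
  by (rule veblen_young[of a b c d "line a b" "line c d"])
    (use assms in \<open>auto simp: line_in_lines left_in_line right_in_line\<close>)

definition join :: "'p \<Rightarrow> 'p set \<Rightarrow> 'p set" where
  "join p X = insert p (\<Union>q\<in>X. line p q)"

lemma mem_join_iff:
  assumes "p \<notin> X" "z \<noteq> p"
  shows "z \<in> join p X \<longleftrightarrow> line p z \<inter> X \<noteq> {}"
proof
  assume "z \<in> join p X"
  then obtain q where q: "q \<in> X" "z \<in> line p q"
    using assms by (auto simp: join_def)
  then have "p \<noteq> q" using assms by auto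
  then have "q \<in> line p z" using q assms line_cong right_in_line by metis
  then show "line p z \<inter> X \<noteq> {}" using q by auto
next
  assume "line p z \<inter> X \<noteq> {}"
  then obtain q where q: "q \<in> X" "q \<in> line p z" by auto
  then have "line p q = line p z"
    using assms by (intro line_cong) auto
  then show "z \<in> join p X"
    using q assms right_in_line[of p z] by (auto simp: join_def)
qed

lemma subset_join: "p \<notin> X \<Longrightarrow> X \<subseteq> join p X"
proof
  fix q assume "p \<notin> X" "q \<in> X"
  then have "q \<in> line p q" by (intro right_in_line) auto
  with \<open>q \<in> X\<close> show "q \<in> join p X" by (auto simp: join_def)
qed

lemma line_subset_join:
  assumes "p \<notin> X" "w \<in> join p X" "w \<noteq> p"
  shows "line p w \<subseteq> join p X"
proof -
  obtain q where q: "q \<in> line p w" "q \<in> X"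
    using assms mem_join_iff[OF assms(1,3)] by auto
  then have "line p q = line p w"
    using assms by (intro line_cong) auto
  then show ?thesis using q by (auto simp: join_def)
qed

lemma line_in_join_meets_subspace:
  assumes X: "proj_subspace lines X" "p \<notin> X"
    and xy: "x \<in> join p X" "y \<in> join p X" "x \<noteq> y" and p: "p \<notin> line x y"
  shows "line x y \<inter> X \<noteq> {}"
proof (cases "x \<in> X \<or> y \<in> X")
  case True
  then show ?thesis using xy left_in_line right_in_line by blast
next
  case False
  have "x \<noteq> p" "y \<noteq> p" using p xy left_in_line right_in_line by auto
  then obtain q q' where q: "q \<in> line p x" "q \<in> X" and q': "q' \<in> line p y" "q' \<in> X"
    using xy mem_join_iff[OF X(2), of x] mem_join_iff[OF X(2), of y] by auto
  have "line p q = line p x"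
    using q X(2) \<open>x \<noteq> p\<close> by (intro line_cong) auto
  have "line p q' = line p y"
    using q' X(2) \<open>y \<noteq> p\<close> by (intro line_cong) auto
  have "q \<noteq> q'"
  proof
    assume "q = q'"
    then have "y \<in> line x p"
      using \<open>line p q = line p x\<close> \<open>line p q' = line p y\<close> right_in_line[of p y] \<open>y \<noteq> p\<close>
      by (simp add: line_commute)
    then have "line x y = line x p"
      using \<open>x \<noteq> p\<close> xy(3) by (intro line_cong) auto
    then show False using p right_in_line[OF \<open>x \<noteq> p\<close>] by simp
  qed
  have "p \<in> line x q" "p \<in> line y q'"
    using q q' False \<open>x \<noteq> p\<close> \<open>y \<noteq> p\<close> line_cong[of x p q] line_cong[of y p q']
      right_in_line[of x p] right_in_line[of y p] by (auto simp: line_commute)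
  then have "line x y \<inter> line q q' \<noteq> {}"
    using False q q' xy(3) \<open>q \<noteq> q'\<close> by (intro veblen_young_line[of x q y q']) auto
  moreover have "line q q' \<subseteq> X"
    using X q q' \<open>q \<noteq> q'\<close> by (intro line_subset_subspace)
  ultimately show ?thesis by blast
qed

lemma line_meeting_subspace_subset_join:
  assumes X: "proj_subspace lines X" "p \<notin> X"
    and x: "x \<in> join p X" "x \<notin> X" and r: "r \<in> X" and p: "p \<notin> line x r"
  shows "line x r \<subseteq> join p X"
proof
  fix z assume z: "z \<in> line x r"
  show "z \<in> join p X"
  proof (cases "z = x \<or> z \<in> X")
    case True
    then show ?thesis using x subset_join[OF X(2)] by auto
  next
    case False
    have ne: "x \<noteq> r" "z \<noteq> r" "x \<noteq> p" "z \<noteq> p"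
      using x r z p False left_in_line[of x r] by auto
    obtain q where q: "q \<in> line p x" "q \<in> X"
      using x ne mem_join_iff[OF X(2), of x] by auto
    have "line p q = line p x"
      using q X(2) ne by (intro line_cong) auto
    then have xq: "x \<in> line p q" using ne right_in_line by simp
    have "q \<noteq> r"
      using xq p ne X(2) r line_cong[of r p x] right_in_line[of r p] by (auto simp: line_commute)
    have "line z r = line x r"
      using z ne line_cong[of r x z] by (simp add: line_commute)
    then have "x \<in> line z r" using ne left_in_line by simp
    with xq have "line p z \<inter> line q r \<noteq> {}"
      using X(2) False q r ne \<open>q \<noteq> r\<close> by (intro veblen_young_line[of p q z r]) auto
    moreover have "line q r \<subseteq> X"
      using X q r \<open>q \<noteq> r\<close> by (intro line_subset_subspace)
    ultimately show ?thesis
      using mem_join_iff[OF X(2), of z] ne by blast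
  qed
qed

lemma proj_subspace_join:
  assumes X: "proj_subspace lines X" "p \<notin> X"
  shows "proj_subspace lines (join p X)"
  unfolding proj_subspace_def
proof (intro ballI impI)
  fix l x y
  assume l: "l \<in> lines" and x: "x \<in> join p X \<inter> l" and y: "y \<in> join p X \<inter> l" and "x \<noteq> y"
  have l_eq: "line v w = l" if "v \<in> l" "w \<in> l" "v \<noteq> w" for v w
    using that l by (intro line_eqI)
  consider (through_p) "p \<in> l" | (inside) "x \<in> X" "y \<in> X"
    | (outside) w where "p \<notin> l" "w \<in> {x, y}" "w \<notin> X"
    by blast
  then show "l \<subseteq> join p X"
  proof cases
    case through_p
    obtain w where "w \<in> join p X" "w \<in> l" "w \<noteq> p" using x y \<open>x \<noteq> y\<close> by auto
    then show ?thesis using line_subset_join[OF X(2), of w] l_eq[OF through_p, of w] by auto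
  next
    case inside
    then have "l \<subseteq> X"
      using X l x y \<open>x \<noteq> y\<close> by (intro proj_subspaceD[of lines X l x y]) auto
    then show ?thesis using subset_join[OF X(2)] by auto
  next
    case outside
    then obtain r where r: "r \<in> l" "r \<in> X"
      using line_in_join_meets_subspace[OF X, of x y] l_eq[of x y] x y \<open>x \<noteq> y\<close> by auto
    then have "line w r = l" using outside x y by (intro l_eq) auto
    then show ?thesis
      using line_meeting_subspace_subset_join[OF X, of w r] outside x y r by auto
  qed
qed

lemma proj_span_insert_eq_join:
  assumes "p \<notin> proj_span lines S"
  shows "proj_span lines (insert p S) = join p (proj_span lines S)"
proof
  let ?X = "proj_span lines S"
  have X: "proj_subspace lines ?X" by (rule proj_subspace_span)
  have "insert p S \<subseteq> join p ?X"
    using subset_join[OF assms] proj_span_superset[of S lines] by (auto simp: join_def)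
  then show "proj_span lines (insert p S) \<subseteq> join p ?X"
    by (intro proj_span_minimal proj_subspace_join X assms)
  have "insert p ?X \<subseteq> proj_span lines (insert p S)"
    using proj_span_superset[of "insert p S" lines] proj_span_mono[of S "insert p S" lines] by auto
  then show "join p ?X \<subseteq> proj_span lines (insert p S)"
    using assms line_subset_subspace[OF proj_subspace_span] by (fastforce simp: join_def)
qed

text \<open>If \<open>q\<close> lies on exactly the subspaces \<open>H x\<close> with \<open>x \<notin> I\<close>, then a third point of the line
  joining it to \<open>p\<close> lies on exactly those with \<open>x \<notin> insert p I\<close>.\<close>

lemma ex_point_on_exactly:
  assumes H: "\<And>x. x \<in> B \<Longrightarrow> proj_subspace lines (H x)"
    and B: "\<And>x y. x \<in> B \<Longrightarrow> y \<in> B \<Longrightarrow> y \<in> H x \<longleftrightarrow> y \<noteq> x"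
    and I: "I \<subseteq> B" "I \<noteq> {}"
  shows "\<exists>q. \<forall>x\<in>B. q \<in> H x \<longleftrightarrow> x \<notin> I"
proof -
  have "finite I" by simp
  then show ?thesis using I(2,1)
  proof (induction I rule: finite_ne_induct)
    case (singleton p)
    then show ?case using B by auto
  next
    case (insert p I)
    then obtain q where q: "\<And>x. x \<in> B \<Longrightarrow> q \<in> H x \<longleftrightarrow> x \<notin> I" by auto
    have p: "\<And>x. x \<in> B \<Longrightarrow> p \<in> H x \<longleftrightarrow> x \<noteq> p" using B insert.prems by auto
    have "p \<noteq> q" using p[of p] q[of p] insert by auto
    have "\<not> line p q \<subseteq> {p, q}"
    proof
      assume "line p q \<subseteq> {p, q}"
      then have "card (line p q) \<le> card {p, q}" by (intro card_mono) auto
      then show False using three_points[OF line_in_lines[OF \<open>p \<noteq> q\<close>]] \<open>p \<noteq> q\<close> by simp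
    qed
    then obtain r where r: "r \<in> line p q" "r \<noteq> p" "r \<noteq> q" by auto
    have "r \<in> H x \<longleftrightarrow> x \<notin> insert p I" if x: "x \<in> B" for x
    proof (cases "x = p \<or> x \<in> I")
      case True
      then have "p \<in> H x \<longleftrightarrow> q \<notin> H x" using p[OF x] q[OF x] insert.hyps(3) by auto
      then have "r \<notin> H x"
        using line_meets_subspace_once[OF H[OF x]] r by (metis line_commute)
      then show ?thesis using True by auto
    next
      case False
      then have "line p q \<subseteq> H x"
        using p q x \<open>p \<noteq> q\<close> by (intro line_subset_subspace H) auto
      then show ?thesis using False r by auto
    qed
    then show ?case by auto
  qed
qed

end

section \<open>Counting in spaces of order \<open>n\<close>\<close>

definition geom_sum :: "nat \<Rightarrow> nat \<Rightarrow> nat" where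
  "geom_sum n r = (\<Sum>i<r. n ^ i)"

lemma geom_sum_0 [simp]: "geom_sum n 0 = 0"
  by (simp add: geom_sum_def)

lemma geom_sum_1 [simp]: "geom_sum n (Suc 0) = 1"
  by (simp add: geom_sum_def)

lemma geom_sum_Suc: "geom_sum n (Suc r) = geom_sum n r + n ^ r"
  by (simp add: geom_sum_def)

lemma geom_sum_Suc_shift: "geom_sum n (Suc r) = 1 + n * geom_sum n r"
  by (simp only: geom_sum_def sum.lessThan_Suc_shift power_Suc power_0 sum_distrib_left)

lemma geom_sum_add: "geom_sum n (r + s) = geom_sum n r + n ^ r * geom_sum n s"
  by (induction s) (simp_all add: geom_sum_Suc power_add algebra_simps)

lemma strict_mono_geom_sum: "n > 0 \<Longrightarrow> strict_mono (geom_sum n)"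
  by (simp add: strict_mono_Suc_iff geom_sum_Suc)

lemma geom_sum_pos: "r > 0 \<Longrightarrow> geom_sum n r > 0"
  by (cases r) (simp_all add: geom_sum_Suc_shift)

lemma double_Suc_geom_sum_le:
  assumes "n \<ge> 3" "r \<ge> 1"
  shows "2 * (geom_sum n r + 1) \<le> geom_sum n (r + 1)"
proof -
  have "2 * (geom_sum n r + 1) \<le> 1 + 3 * geom_sum n r"
    using geom_sum_pos[of r n] assms(2) by simp
  also have "\<dots> \<le> geom_sum n (r + 1)"
    using assms(1) by (simp add: geom_sum_Suc_shift)
  finally show ?thesis .
qed

lemma of_nat_geom_sum: "real (geom_sum n r) * (real n - 1) = real n ^ r - 1"
  by (induction r) (simp_all add: geom_sum_Suc algebra_simps)

lemma geom_sum_Suc_square: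
  "(geom_sum n (Suc r))\<^sup>2 = geom_sum n r * geom_sum n (Suc (Suc r)) + n ^ r"
proof -
  have "(geom_sum n (Suc r))\<^sup>2 = geom_sum n (Suc r) * (1 + n * geom_sum n r)"
    by (simp only: power2_eq_square flip: geom_sum_Suc_shift)
  also have "\<dots> = geom_sum n r * (1 + n * geom_sum n (Suc r)) + n ^ r"
    by (simp add: geom_sum_Suc algebra_simps)
  finally show ?thesis by (simp only: geom_sum_Suc_shift[of n "Suc r"])
qed

locale projective_space_of_order = projective_space +
  fixes n :: nat
  assumes order: "has_order lines n" and order_ge_2: "n \<ge> 2"
begin

lemma geom_sum_less_iff [simp]: "geom_sum n r < geom_sum n s \<longleftrightarrow> r < s"
  and geom_sum_eq_iff [simp]: "geom_sum n r = geom_sum n s \<longleftrightarrow> r = s"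
  using strict_mono_geom_sum[of n] order_ge_2 by (simp_all add: strict_mono_less strict_mono_eq)

lemma card_line: "p \<noteq> q \<Longrightarrow> card (line p q) = n + 1"
  using order line_in_lines[of p q] by (auto simp: has_order_def)

lemma card_join:
  assumes X: "proj_subspace lines X" "p \<notin> X"
  shows "card (join p X) = 1 + n * card X"
proof -
  have ne: "p \<noteq> q" if "q \<in> X" for q using that X by auto
  have disjoint: "(line p q - {p}) \<inter> (line p q' - {p}) = {}"
    if "q \<in> X" "q' \<in> X" "q \<noteq> q'" for q q'
  proof (rule ccontr)
    assume "(line p q - {p}) \<inter> (line p q' - {p}) \<noteq> {}"
    then obtain z where "z \<in> line p q" "z \<in> line p q'" "z \<noteq> p" by auto
    then have "line p q = line p q'"
      using line_cong[of p q z] line_cong[of p q' z] ne that by simp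
    then have "q' \<in> line p q" using right_in_line[OF ne] that by simp
    then show False using line_meets_subspace_once[OF X, of q q'] that by simp
  qed
  have "join p X = insert p (\<Union>q\<in>X. line p q - {p})" by (auto simp: join_def)
  also have "card \<dots> = 1 + card (\<Union>q\<in>X. line p q - {p})"
    by (subst card_insert_disjoint) auto
  also have "card (\<Union>q\<in>X. line p q - {p}) = (\<Sum>q\<in>X. card (line p q - {p}))"
    using disjoint by (intro card_UN_disjoint) auto
  also have "\<dots> = (\<Sum>q\<in>X. n)"
    using ne left_in_line card_line by (intro sum.cong) auto
  finally show ?thesis by simp
qed

lemma card_span_insert:
  "p \<notin> proj_span lines S \<Longrightarrow>
    card (proj_span lines (insert p S)) = 1 + n * card (proj_span lines S)"
  by (simp add: proj_span_insert_eq_join card_join proj_subspace_span)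

lemma card_span_empty: "card (proj_span lines {}) = 0"
  by (simp add: proj_span_subspace proj_subspace_empty)

lemma card_span_le: "card (proj_span lines S) \<le> geom_sum n (card S)"
  using finite[of S]
proof (induction S)
  case empty
  show ?case by (simp add: card_span_empty)
next
  case (insert p S)
  show ?case
  proof (cases "p \<in> proj_span lines S")
    case True
    then show ?thesis using insert by (simp add: proj_span_insert_absorb geom_sum_Suc)
  next
    case False
    then show ?thesis using insert by (simp add: card_span_insert geom_sum_Suc_shift)
  qed
qed

lemma card_span_independent:
  assumes "proj_independent lines B"
  shows "card (proj_span lines B) = geom_sum n (card B)"
  using finite[of B] assms
proof (induction B)
  case empty
  show ?case by (simp add: card_span_empty)
next
  case (insert p B)
  then have "p \<notin> proj_span lines B" "proj_independent lines B"
    using proj_independent_subset[of lines "insert p B" B] by (auto simp: proj_independent_def)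
  then show ?case using insert by (simp add: card_span_insert geom_sum_Suc_shift)
qed

lemma proj_independent_iff_card_span:
  "proj_independent lines B \<longleftrightarrow> card (proj_span lines B) = geom_sum n (card B)"
proof
  assume card: "card (proj_span lines B) = geom_sum n (card B)"
  show "proj_independent lines B"
    unfolding proj_independent_def
  proof (intro ballI notI)
    fix x assume x: "x \<in> B" "x \<in> proj_span lines (B - {x})"
    then have "proj_span lines B = proj_span lines (B - {x})"
      using proj_span_insert_absorb[OF x(2)] by (simp add: insert_absorb)
    then have "geom_sum n (card B) \<le> geom_sum n (card (B - {x}))"
      using card card_span_le[of "B - {x}"] by simp
    moreover have "card (B - {x}) < card B"
      using x by (intro card_Diff1_less) auto
    ultimately show False by (simp flip: not_less)
  qed
qed (rule card_span_independent)

lemma proj_subspace_obtains_basis: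
  assumes "proj_subspace lines X"
  obtains B where "proj_independent lines B" "proj_span lines B = X" "card X = geom_sum n (card B)"
proof -
  let ?F = "{B. B \<subseteq> X \<and> proj_independent lines B}"
  have "{} \<in> ?F" by (simp add: proj_independent_def)
  then obtain B where B: "B \<subseteq> X" "proj_independent lines B"
    and maximal: "\<And>C. C \<in> ?F \<Longrightarrow> B \<subseteq> C \<Longrightarrow> B = C"
    using finite_has_maximal[of ?F] by auto
  have "p \<in> proj_span lines B" if "p \<in> X" for p
  proof (rule ccontr)
    assume p: "p \<notin> proj_span lines B"
    then have "p \<notin> B" using proj_span_superset[of B lines] by auto
    with p B(2) have "proj_independent lines (insert p B)"
      by (simp add: proj_independent_iff_card_span card_span_insert geom_sum_Suc_shift)
    then show False using maximal[of "insert p B"] B(1) that \<open>p \<notin> B\<close> by auto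
  qed
  then have "proj_span lines B = X"
    using proj_span_minimal[OF assms B(1)] by auto
  then show ?thesis using that[OF B(2)] card_span_independent[OF B(2)] by simp
qed

lemma has_proj_dim_iff_card:
  assumes "proj_subspace lines X"
  shows "has_proj_dim lines X k \<longleftrightarrow> card X = geom_sum n (k + 1)"
proof
  show "has_proj_dim lines X k \<Longrightarrow> card X = geom_sum n (k + 1)"
    using card_span_independent by (auto simp: has_proj_dim_def)
  assume "card X = geom_sum n (k + 1)"
  with proj_subspace_obtains_basis[OF assms] show "has_proj_dim lines X k"
    unfolding has_proj_dim_def by (metis geom_sum_eq_iff)
qed

end

locale finite_projective_space = projective_space_of_order +
  fixes d :: nat
  assumes dim: "has_proj_dim lines UNIV d" and dim_pos: "d \<ge> 1"
begin

lemma card_points: "CARD('a) = geom_sum n (d + 1)"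
  using dim has_proj_dim_iff_card[OF proj_subspace_UNIV] by simp

lemma hyperplanes_iff:
  "H \<in> hyperplanes lines d \<longleftrightarrow> proj_subspace lines H \<and> card H = geom_sum n d"
  using has_proj_dim_iff_card[of H "d - 1"] dim_pos by (auto simp: hyperplanes_def)

lemma hyperplane_superset_span_iff:
  "H \<in> hyperplanes lines d \<Longrightarrow> proj_span lines S \<subseteq> H \<longleftrightarrow> S \<subseteq> H"
  by (simp add: hyperplanes_iff proj_span_subset_iff)

text \<open>Counts the pairs of a hyperplane \<open>H\<close> containing \<open>X\<close> and a point of \<open>H - X\<close>.\<close>

lemma card_hyperplanes_double_count:
  assumes X: "card X = geom_sum n r" "r + m = d"
    and k: "\<And>p. p \<notin> X \<Longrightarrow> card {H \<in> hyperplanes lines d. insert p X \<subseteq> H} = k"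
  shows "card {H \<in> hyperplanes lines d. X \<subseteq> H} * geom_sum n m = k * geom_sum n (Suc m)"
proof -
  let ?S = "{H \<in> hyperplanes lines d. X \<subseteq> H}"
  have "card {p \<in> - X. p \<in> H} = n ^ r * geom_sum n m" if "H \<in> ?S" for H
  proof -
    have "{p \<in> - X. p \<in> H} = H - X" by auto
    then show ?thesis
      using that X geom_sum_add[of n r m] by (simp add: hyperplanes_iff card_Diff_subset)
  qed
  then have "card ?S * (n ^ r * geom_sum n m) = (\<Sum>H\<in>?S. card {p \<in> - X. p \<in> H})"
    by simp
  also have "\<dots> = k * card (- X)"
    using k by (intro sum_multicount) (simp_all add: conj_ac)
  also have "card (- X) = n ^ r * geom_sum n (Suc m)"
    using card_points X geom_sum_add[of n r "Suc m"]
    by (simp add: Compl_eq_Diff_UNIV card_Diff_subset)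
  finally show ?thesis using order_ge_2 by simp
qed

lemma card_hyperplanes_superset:
  assumes "proj_subspace lines X" "card X = geom_sum n r" "r + m = d + 1"
  shows "card {H \<in> hyperplanes lines d. X \<subseteq> H} = geom_sum n m"
  using assms
proof (induction m arbitrary: X r rule: induct_nat_012)
  case 0
  have "\<not> X \<subseteq> H" if "card H = geom_sum n d" for H
    using card_mono[of H X] 0 that by (auto simp flip: not_less)
  then show ?case by (simp add: hyperplanes_iff)
next
  case 1
  then have "{H \<in> hyperplanes lines d. X \<subseteq> H} = {X}"
    by (auto simp: hyperplanes_iff dest: card_subset_eq[OF finite])
  then show ?case by simp
next
  case (ge2 m)
  have "card {H \<in> hyperplanes lines d. insert p X \<subseteq> H} = geom_sum n (Suc m)" if p: "p \<notin> X" for p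
  proof -
    let ?Y = "proj_span lines (insert p X)"
    have "card ?Y = geom_sum n (Suc r)"
      using card_span_insert[of p X] ge2.prems p
      by (simp add: proj_span_subspace geom_sum_Suc_shift)
    then have "card {H \<in> hyperplanes lines d. ?Y \<subseteq> H} = geom_sum n (Suc m)"
      using ge2.IH(2)[OF proj_subspace_span, of "insert p X" "Suc r"] ge2.prems by simp
    moreover have "{H \<in> hyperplanes lines d. ?Y \<subseteq> H} = {H \<in> hyperplanes lines d. insert p X \<subseteq> H}"
      using hyperplane_superset_span_iff by auto
    ultimately show ?thesis by simp
  qed
  then have "card {H \<in> hyperplanes lines d. X \<subseteq> H} * geom_sum n (Suc m)
      = geom_sum n (Suc m) * geom_sum n (Suc (Suc m))"
    using ge2.prems by (intro card_hyperplanes_double_count) auto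
  then show ?case using geom_sum_pos[of "Suc m" n] by simp
qed

lemma card_hyperplanes: "card (hyperplanes lines d) = geom_sum n (d + 1)"
  using card_hyperplanes_superset[OF proj_subspace_empty, of 0 "d + 1"] by simp

lemma card_hyperplanes_point: "card {H \<in> hyperplanes lines d. p \<in> H} = geom_sum n d"
  using card_hyperplanes_superset[OF proj_subspace_singleton, of p 1 d] by simp

lemma card_hyperplanes_two_points:
  assumes "p \<noteq> q"
  shows "card {H \<in> hyperplanes lines d. p \<in> H \<and> q \<in> H} = geom_sum n (d - 1)"
proof -
  have "card (proj_span lines {p, q}) = geom_sum n 2"
    using card_span_insert[of p "{q}"] assms
    by (simp add: proj_span_subspace proj_subspace_singleton numeral_2_eq_2 geom_sum_Suc_shift)
  then have "card {H \<in> hyperplanes lines d. proj_span lines {p, q} \<subseteq> H} = geom_sum n (d - 1)"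
    using dim_pos by (intro card_hyperplanes_superset[OF proj_subspace_span]) auto
  moreover have "{H \<in> hyperplanes lines d. proj_span lines {p, q} \<subseteq> H}
      = {H \<in> hyperplanes lines d. p \<in> H \<and> q \<in> H}"
    using hyperplane_superset_span_iff by auto
  ultimately show ?thesis by simp
qed

end

section \<open>The VC dimension\<close>

lemma shattered_signed_incidence_iff:
  "shattered (signed_incidence blk) C \<longleftrightarrow> (\<forall>T\<subseteq>C. \<exists>p. \<forall>h\<in>C. p \<in> blk h \<longleftrightarrow> h \<in> T)"
proof
  assume shattered: "shattered (signed_incidence blk) C"
  show "\<forall>T\<subseteq>C. \<exists>p. \<forall>h\<in>C. p \<in> blk h \<longleftrightarrow> h \<in> T"
  proof (intro allI impI)
    fix T
    have "\<exists>p. \<forall>h\<in>C. signed_incidence blk $ p $ h = (if h \<in> T then 1 else -1)"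
      using shattered unfolding shattered_def
      by (elim allE[of _ "\<lambda>h. if h \<in> T then 1 else -1"]) auto
    then obtain p where "\<forall>h\<in>C. signed_incidence blk $ p $ h = (if h \<in> T then 1 else -1)" ..
    then have "\<forall>h\<in>C. p \<in> blk h \<longleftrightarrow> h \<in> T"
      by (auto simp: signed_incidence_def split: if_splits)
    then show "\<exists>p. \<forall>h\<in>C. p \<in> blk h \<longleftrightarrow> h \<in> T" ..
  qed
next
  assume traces: "\<forall>T\<subseteq>C. \<exists>p. \<forall>h\<in>C. p \<in> blk h \<longleftrightarrow> h \<in> T"
  show "shattered (signed_incidence blk) C"
    unfolding shattered_def
  proof (intro allI impI)
    fix f :: "'a \<Rightarrow> real" assume f: "\<forall>h\<in>C. f h \<in> {-1, 1}"
    obtain p where "\<forall>h\<in>C. p \<in> blk h \<longleftrightarrow> h \<in> {h \<in> C. f h = 1}"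
      using traces[rule_format, of "{h \<in> C. f h = 1}"] by auto
    then have "\<forall>h\<in>C. signed_incidence blk $ p $ h = f h"
      using f by (auto simp: signed_incidence_def)
    then show "\<exists>p. \<forall>h\<in>C. signed_incidence blk $ p $ h = f h" ..
  qed
qed

lemma vc_dim_eqI:
  assumes "shattered S C" "card C = d" and "\<And>C. shattered S C \<Longrightarrow> card C \<le> d"
  shows "vc_dim S = d"
  unfolding vc_dim_def by (rule Max_eqI) (use assms in auto)

context finite_projective_space
begin

lemma card_Inter_irredundant_subspaces:
  assumes hyp: "\<And>h. h \<in> C \<Longrightarrow> proj_subspace lines (hyp h)"
    and drop: "\<And>h T. insert h T \<subseteq> C \<Longrightarrow> h \<notin> T \<Longrightarrow> \<not> (\<Inter>h\<in>T. hyp h) \<subseteq> hyp h"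
    and "finite C"
  obtains r where "card (\<Inter>h\<in>C. hyp h) = geom_sum n r" "r + card C \<le> d + 1"
proof -
  have "\<exists>r. card (\<Inter>h\<in>T. hyp h) = geom_sum n r \<and> r + card T \<le> d + 1" if "T \<subseteq> C" for T
    using finite_subset[OF that \<open>finite C\<close>] that
  proof (induction T)
    case empty
    then show ?case using card_points by auto
  next
    case (insert h T)
    then obtain r where r: "card (\<Inter>h\<in>T. hyp h) = geom_sum n r" "r + card T \<le> d + 1" by auto
    have "proj_subspace lines (\<Inter>h\<in>insert h T. hyp h)"
      using hyp insert.prems by (intro proj_subspace_Inter) auto
    then obtain s where s: "card (\<Inter>h\<in>insert h T. hyp h) = geom_sum n s"
      by (metis proj_subspace_obtains_basis)
    have "(\<Inter>h\<in>insert h T. hyp h) \<subset> (\<Inter>h\<in>T. hyp h)"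
      using drop[OF insert.prems insert.hyps(2)] by auto
    then have "s < r"
      using psubset_card_mono[OF finite] r s by (metis geom_sum_less_iff)
    then show ?case using s r insert.hyps by auto
  qed
  then show ?thesis using that by blast
qed

lemma card_shattered_le:
  assumes hyp: "range hyp \<subseteq> hyperplanes lines d" and "shattered (signed_incidence hyp) C"
  shows "card C \<le> d"
proof -
  have traces: "\<exists>p. \<forall>h\<in>C. p \<in> hyp h \<longleftrightarrow> h \<in> T" if "T \<subseteq> C" for T
    using assms(2) that by (simp add: shattered_signed_incidence_iff)
  obtain r where r: "card (\<Inter>h\<in>C. hyp h) = geom_sum n r" "r + card C \<le> d + 1"
  proof (rule card_Inter_irredundant_subspaces)
    show "proj_subspace lines (hyp h)" for h
      using hyp hyperplanes_iff by blast
    fix h T assume "insert h T \<subseteq> C" "h \<notin> T"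
    moreover from this obtain p where "\<forall>h\<in>C. p \<in> hyp h \<longleftrightarrow> h \<in> T" using traces[of T] by auto
    ultimately have "p \<in> (\<Inter>h\<in>T. hyp h)" "p \<notin> hyp h" by auto
    then show "\<not> (\<Inter>h\<in>T. hyp h) \<subseteq> hyp h" by blast
  qed auto
  have "(\<Inter>h\<in>C. hyp h) \<noteq> {}" using traces[of C] by auto
  then have "r \<noteq> 0" using r(1) by (intro notI) simp
  then show ?thesis using r(2) by simp
qed

lemma ex_shattered_card_eq_dim:
  assumes hyp: "hyperplanes lines d \<subseteq> range hyp"
  obtains C where "shattered (signed_incidence hyp) C" "card C = d"
proof -
  obtain B where B: "proj_independent lines B" "card B = d + 1"
    using dim by (auto simp: has_proj_dim_def)
  then obtain b where "b \<in> B" by fastforce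
  define H where "H x = proj_span lines (B - {x})" for x
  have "H x \<in> hyperplanes lines d" if "x \<in> B" for x
    using card_span_independent[OF proj_independent_subset[OF B(1), of "B - {x}"]] that B(2)
    by (auto simp: H_def hyperplanes_iff proj_subspace_span)
  then have "\<forall>x\<in>B. \<exists>h. hyp h = H x" using hyp by fastforce
  then obtain g where g: "\<And>x. x \<in> B \<Longrightarrow> hyp (g x) = H x" by metis
  have H: "y \<in> H x \<longleftrightarrow> y \<noteq> x" if "x \<in> B" "y \<in> B" for x y
    using that B(1) proj_span_superset[of "B - {x}" lines]
    by (auto simp: H_def proj_independent_def)
  have "inj_on g B" by (rule inj_onI) (metis g H)
  have "\<exists>q. \<forall>h\<in>g ` (B - {b}). q \<in> hyp h \<longleftrightarrow> h \<in> T" for T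
  proof -
    \<comment> \<open>The point \<open>b\<close> is set aside so that the set of missed hyperplanes is never empty.\<close>
    let ?I = "insert b {x \<in> B. g x \<notin> T}"
    obtain q where "\<forall>x\<in>B. q \<in> H x \<longleftrightarrow> x \<notin> ?I"
      using ex_point_on_exactly[of B H ?I] H \<open>b \<in> B\<close> by (auto simp: H_def proj_subspace_span)
    then show ?thesis using g by auto
  qed
  then have "shattered (signed_incidence hyp) (g ` (B - {b}))"
    by (simp add: shattered_signed_incidence_iff)
  moreover have "card (g ` (B - {b})) = d"
    using \<open>inj_on g B\<close> \<open>b \<in> B\<close> B(2) by (simp add: card_image inj_on_diff)
  ultimately show ?thesis by (rule that)
qed

theorem vc_dim_signed_incidence:
  assumes "range hyp = hyperplanes lines d"
  shows "vc_dim (signed_incidence hyp) = d"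
proof -
  obtain C where "shattered (signed_incidence hyp) C" "card C = d"
    using ex_shattered_card_eq_dim assms by blast
  then show ?thesis using card_shattered_le assms by (intro vc_dim_eqI) auto
qed

end

section \<open>Forster's bound\<close>

subsection \<open>Determinants\<close>

lemma abs_det_le_prod_norm:
  fixes A :: "real^'m^'m"
  shows "\<bar>det A\<bar> \<le> fact CARD('m) * (\<Prod>i\<in>UNIV. norm (A $ i))"
proof -
  have "\<bar>det A\<bar> \<le> (\<Sum>p | p permutes (UNIV :: 'm set). \<bar>of_int (sign p) * (\<Prod>i\<in>UNIV. A $ i $ p i)\<bar>)"
    unfolding det_def by (rule sum_abs)
  also have "\<dots> \<le> (\<Sum>p | p permutes (UNIV :: 'm set). (\<Prod>i\<in>UNIV. norm (A $ i)))"
    by (intro sum_mono)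
      (auto simp: abs_mult sign_def abs_prod intro!: prod_mono component_le_norm_cart)
  also have "\<dots> = fact CARD('m) * (\<Prod>i\<in>UNIV. norm (A $ i))"
    by (simp add: card_permutations)
  finally show ?thesis .
qed

definition rank_one_update :: "real \<Rightarrow> real^'m \<Rightarrow> real^'m^'m" where
  "rank_one_update t v = mat 1 + (\<chi> i j. t * v $ i * v $ j)"

lemma rank_one_update_mult:
  "rank_one_update t v *v y = y + (t * (v \<bullet> y)) *\<^sub>R v"
proof -
  have "(\<chi> i j. t * v $ i * v $ j) *v y = (t * (v \<bullet> y)) *\<^sub>R v"
    by (simp add: vec_eq_iff matrix_vector_mult_def inner_vec_def sum_distrib_left mult_ac)
  then show ?thesis
    by (simp add: rank_one_update_def matrix_vector_mult_add_rdistrib)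
qed

lemma det_rank_one_update:
  fixes v :: "real^'m"
  shows "det (rank_one_update t v) = 1 + t * (v \<bullet> v)"
proof -
  fix k :: 'm
  have "norm (norm v *\<^sub>R axis k (1::real)) = norm v" by simp
  then obtain f :: "real^'m \<Rightarrow> real^'m"
    where f: "orthogonal_transformation f" "f (norm v *\<^sub>R axis k 1) = v"
    by (rule orthogonal_transformation_exists)
  define Q where "Q = matrix f"
  have Q: "orthogonal_matrix Q" "Q *v (norm v *\<^sub>R axis k 1) = v"
    using f by (auto simp: Q_def orthogonal_transformation_matrix matrix_works)
  have "(Q *v (norm v *\<^sub>R axis k 1)) $ i = norm v * Q $ i $ k" for i
    by (simp add: matrix_vector_mult_scaleR matrix_vector_mult_basis column_def)
  then have v: "v $ i = norm v * Q $ i $ k" for i by (simp only: Q(2))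
  define D :: "real^'m^'m"
    where "D = (\<chi> i j. if i = j then if i = k then 1 + t * (v \<bullet> v) else 1 else 0)"
  have QD: "(Q ** D) $ i $ j = Q $ i $ j + (if j = k then t * (v \<bullet> v) * Q $ i $ k else 0)" for i j
    by (simp add: D_def matrix_matrix_mult_def if_distrib[where f = "\<lambda>x. _ * x"]
        algebra_simps cong: if_cong)
  have mult_transpose: "(A ** transpose Q) $ i $ j = (\<Sum>l\<in>UNIV. A $ i $ l * Q $ j $ l)"
    for A :: "real^'m^'m" and i j by (simp add: matrix_matrix_mult_def transpose_def)
  have vv: "v \<bullet> v * (Q $ i $ k * Q $ j $ k) = v $ i * v $ j" for i j
    by (simp only: v[of i] v[of j] dot_square_norm) (simp add: power2_eq_square)
  have "(Q ** D ** transpose Q) $ i $ j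
      = (Q ** transpose Q) $ i $ j + t * (v \<bullet> v * (Q $ i $ k * Q $ j $ k))" for i j
    by (simp add: mult_transpose QD distrib_right sum.distrib if_distrib[where f = "\<lambda>x. x * _"]
        cong: if_cong)
  then have "Q ** D ** transpose Q = rank_one_update t v"
    using Q(1) by (simp add: vv vec_eq_iff rank_one_update_def orthogonal_matrix_def mult.assoc)
  then have "det (rank_one_update t v) = (det Q)\<^sup>2 * det D"
    by (simp add: det_mul power2_eq_square flip: \<open>Q ** D ** transpose Q = rank_one_update t v\<close>)
  also have "det D = 1 + t * (v \<bullet> v)"
    by (subst det_diagonal) (auto simp: D_def)
  also have "(det Q)\<^sup>2 = 1"
    using det_orthogonal_matrix[OF Q(1)] by auto
  finally show ?thesis by simp
qed

lemma abs_det_le_basis: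
  fixes E :: "(real^'m) set"
  assumes "independent E" "card E = CARD('m)"
  obtains c where "c > 0" "\<And>B :: real^'m^'m. \<bar>det B\<bar> \<le> c * (\<Prod>e\<in>E. norm (B *v e))"
proof -
  obtain f where f: "bij_betw f (UNIV :: 'm set) E"
    using assms by (metis finite_class.finite_UNIV finite_same_card_bij finiteI_independent)
  define X :: "real^'m^'m" where "X = (\<chi> i. f i)"
  have "rows X = E"
    using f by (auto simp: rows_def row_def X_def bij_betw_def)
  then have "rank X = CARD('m)"
    using assms by (simp add: row_rank_def dim_eq_card_independent)
  then have X: "det X \<noteq> 0" by (simp add: det_eq_0_rank)
  have "\<bar>det B\<bar> \<le> fact CARD('m) / \<bar>det X\<bar> * (\<Prod>e\<in>E. norm (B *v e))" for B :: "real^'m^'m"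
  proof -
    let ?Y = "X ** transpose B"
    have row: "?Y $ i = B *v f i" for i
      by (simp add: vec_eq_iff matrix_matrix_mult_def matrix_vector_mult_def transpose_def X_def
          mult.commute)
    have "\<bar>det X\<bar> * \<bar>det B\<bar> = \<bar>det ?Y\<bar>" by (simp add: det_mul abs_mult)
    also have "\<dots> \<le> fact CARD('m) * (\<Prod>i\<in>UNIV. norm (B *v f i))"
      using abs_det_le_prod_norm[of ?Y] by (simp add: row)
    also have "(\<Prod>i\<in>UNIV. norm (B *v f i)) = (\<Prod>e\<in>E. norm (B *v e))"
      using f by (rule prod.reindex_bij_betw)
    finally show ?thesis using X by (simp add: field_simps)
  qed
  then show ?thesis using X by (intro that[of "fact CARD('m) / \<bar>det X\<bar>"]) auto
qed

definition identity_on :: "(real^'m) set \<Rightarrow> real^'m^'m \<Rightarrow> bool" where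
  "identity_on W B \<longleftrightarrow> (\<forall>w\<in>W. B *v w = w)"

lemma identity_onD: "identity_on W B \<Longrightarrow> w \<in> W \<Longrightarrow> B *v w = w"
  by (simp add: identity_on_def)

lemma independent_Un_orthogonal_comp:
  fixes V :: "'a::euclidean_space set"
  assumes V: "subspace V" and E: "independent E" "E \<subseteq> V" "card E = dim V"
    and W: "independent W" "W \<subseteq> V\<^sup>\<bottom>" "card W = dim (V\<^sup>\<bottom>)"
  shows "independent (E \<union> W)" "card (E \<union> W) = DIM('a)" "E \<inter> W = {}"
proof -
  have fin: "finite E" "finite W" using E W by (auto intro: finiteI_independent)
  have "E \<inter> W \<subseteq> {0}"
    using E(2) W(2) orthogonal_Int_0[OF V] by blast
  then show disj: "E \<inter> W = {}"
    using E(1) dependent_zero by auto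
  have "dim V + dim (V\<^sup>\<bottom>) = DIM('a)"
    using dim_subspace_orthogonal_to_vectors[of V UNIV] V
    by (simp add: orthogonal_comp_def orthogonal_commute)
  then show card: "card (E \<union> W) = DIM('a)"
    using card_Un_disjoint[OF fin disj] E W by simp
  have "V \<subseteq> span E" "V\<^sup>\<bottom> \<subseteq> span W"
    using E W by (simp_all add: card_ge_dim_independent)
  then have "V + V\<^sup>\<bottom> \<subseteq> span (E \<union> W)"
    using span_mono[of E "E \<union> W"] span_mono[of W "E \<union> W"]
    by (intro subspace_sum_minimal subspace_span) auto
  then show "independent (E \<union> W)"
    using subspace_sum_orthogonal_comp[OF V] fin card
    by (intro card_le_dim_spanning[of _ UNIV]) auto
qed

lemma abs_det_le_subspace_basis:
  fixes V :: "(real^'m) set"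
  assumes V: "subspace V" and E: "independent E" "E \<subseteq> V" "card E = dim V"
  obtains c where "c > 0"
    "\<And>B :: real^'m^'m. identity_on (V\<^sup>\<bottom>) B \<Longrightarrow> \<bar>det B\<bar> \<le> c * (\<Prod>e\<in>E. norm (B *v e))"
proof -
  obtain W where W: "W \<subseteq> V\<^sup>\<bottom>" "\<And>w. w \<in> W \<Longrightarrow> norm w = 1" "independent W"
      "card W = dim (V\<^sup>\<bottom>)"
    using orthonormal_basis_subspace[OF subspace_orthogonal_comp[of V]] by metis
  have EW: "independent (E \<union> W)" "card (E \<union> W) = CARD('m)" "E \<inter> W = {}"
    using independent_Un_orthogonal_comp[OF V E W(3,1,4)] by auto
  then obtain c where "c > 0"
    and c: "\<And>B :: real^'m^'m. \<bar>det B\<bar> \<le> c * (\<Prod>e\<in>E \<union> W. norm (B *v e))"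
    using abs_det_le_basis by blast
  have "(\<Prod>e\<in>E \<union> W. norm (B *v e)) = (\<Prod>e\<in>E. norm (B *v e))" if "identity_on (V\<^sup>\<bottom>) B" for B
  proof -
    have "(\<Prod>e\<in>W. norm (B *v e)) = 1"
      using that W by (intro prod.neutral) (auto simp: identity_on_def)
    then show ?thesis
      using E(1) W(3) EW(3) by (simp add: prod.union_disjoint finiteI_independent)
  qed
  then show ?thesis using \<open>c > 0\<close> c by (intro that[of c]) metis+
qed

subsection \<open>General position\<close>

definition general_position :: "nat \<Rightarrow> 'p set \<Rightarrow> ('p \<Rightarrow> 'a::real_vector) \<Rightarrow> bool" where
  "general_position k P x \<longleftrightarrow>
    (\<forall>S\<subseteq>P. finite S \<longrightarrow> card S \<le> k \<longrightarrow> inj_on x S \<and> independent (x ` S))"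

lemma general_positionD:
  assumes "general_position k P x" "S \<subseteq> P" "finite S" "card S \<le> k"
  shows "inj_on x S" "independent (x ` S)"
  using assms by (auto simp: general_position_def)

lemma general_position_nonzero:
  assumes "general_position k P x" "p \<in> P" "k \<ge> 1"
  shows "x p \<noteq> 0"
  using general_positionD(2)[OF assms(1), of "{p}"] assms(2,3) dependent_single by auto

lemma general_position_insert:
  assumes x: "general_position k P x" and "p \<notin> P"
    and z: "\<And>T. T \<subseteq> P \<Longrightarrow> finite T \<Longrightarrow> card T < k \<Longrightarrow> z \<notin> span (x ` T)"
  shows "general_position k (insert p P) (x(p := z))"
  unfolding general_position_def
proof (intro allI impI)
  fix S assume S: "S \<subseteq> insert p P" "finite S" "card S \<le> k"
  define T where "T = S - {p}"
  have T: "T \<subseteq> P" "finite T" "p \<notin> T" using S by (auto simp: T_def)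
  have "card T \<le> k" unfolding T_def using S card_Diff1_le[of S p] by simp
  have image: "x(p := z) ` T = x ` T" using T by auto
  have inj: "inj_on (x(p := z)) T" and indep: "independent (x(p := z) ` T)"
    using general_positionD[OF x T(1,2) \<open>card T \<le> k\<close>] \<open>p \<notin> T\<close> image by (auto simp: inj_on_def)
  show "inj_on (x(p := z)) S \<and> independent (x(p := z) ` S)"
  proof (cases "p \<in> S")
    case False
    then have "S = T" by (auto simp: T_def)
    then show ?thesis using inj indep by simp
  next
    case True
    then have "S = insert p T" "card T < k"
      using S card_Diff1_less[of S p] by (auto simp: T_def)
    moreover have "z \<notin> span (x ` T)" using z T \<open>card T < k\<close> by blast
    moreover from this have "z \<notin> x ` T" using span_superset[of "x ` T"] by auto
    ultimately show ?thesis
      using inj indep image \<open>p \<notin> T\<close> by (simp add: independent_insertI)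
  qed
qed

lemma subspace_avoid_subspaces:
  fixes V :: "'a::euclidean_space set"
  assumes V: "subspace V" "x \<in> V" and \<U>: "countable \<U>" "\<And>U. U \<in> \<U> \<Longrightarrow> subspace U \<and> dim U < dim V"
    and "e > 0"
  obtains y where "y \<in> V" "dist y x < e" "\<And>U. U \<in> \<U> \<Longrightarrow> y \<notin> U"
proof -
  let ?G = "insert V ((\<lambda>U. V - U) ` \<U>)"
  have "V \<subseteq> closure (\<Inter>?G)"
  proof (rule Baire)
    fix T assume "T \<in> ?G"
    then consider (whole) "T = V" | (removed) U where "U \<in> \<U>" "T = V - U" by auto
    then show "openin (top_of_set V) T \<and> V \<subseteq> closure T"
    proof cases
      case whole
      then show ?thesis by (simp add: closure_subset)
    next
      case removed
      then show ?thesis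
        using \<U>(2) V(1) dense_complement_subspace[of U V]
        by (simp add: Diff_eq closed_subspace open_Compl openin_open_Int)
    qed
  qed (use V \<U> in \<open>auto intro: closed_subspace\<close>)
  then have "x \<in> closure (\<Inter>?G)" using V(2) by blast
  then obtain y where y: "y \<in> \<Inter>?G" "dist y x < e"
    using \<open>e > 0\<close> unfolding closure_approachable by blast
  show ?thesis
  proof
    show "y \<in> V" using y(1) by blast
    show "y \<notin> U" if "U \<in> \<U>" for U using y(1) that by blast
  qed (rule y(2))
qed

lemma perturb_to_general_position:
  fixes V :: "'a::euclidean_space set"
  assumes V: "subspace V" and x: "\<And>p. p \<in> P \<Longrightarrow> x p \<in> V" and "e > 0" and "finite P"
  obtains y where "\<And>p. p \<in> P \<Longrightarrow> y p \<in> V" "\<And>p. p \<in> P \<Longrightarrow> dist (y p) (x p) < e"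
    "general_position (dim V) P y"
proof -
  have "\<exists>y. (\<forall>p\<in>P. y p \<in> V \<and> dist (y p) (x p) < e) \<and> general_position (dim V) P y"
    using \<open>finite P\<close> x
  proof (induction P)
    case empty
    show ?case by (auto simp: general_position_def independent_empty)
  next
    case (insert p P)
    then obtain y where y: "\<forall>p\<in>P. y p \<in> V \<and> dist (y p) (x p) < e" "general_position (dim V) P y"
      by auto
    let ?\<U> = "(\<lambda>T. span (y ` T)) ` {T. T \<subseteq> P \<and> card T < dim V}"
    have "countable ?\<U>"
      using insert.hyps(1) by (intro countable_finite) auto
    moreover have "subspace U \<and> dim U < dim V" if "U \<in> ?\<U>" for U
    proof -
      obtain T where T: "U = span (y ` T)" "T \<subseteq> P" "card T < dim V"
        using \<open>U \<in> ?\<U>\<close> by blast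
      then have "finite T" using insert.hyps(1) finite_subset by blast
      then have "dim U \<le> card T"
        using dim_le_card'[of "y ` T"] card_image_le[of T y] by (simp add: T(1))
      then show ?thesis using T by simp
    qed
    ultimately obtain z where z: "z \<in> V" "dist z (x p) < e" "\<And>U. U \<in> ?\<U> \<Longrightarrow> z \<notin> U"
      using subspace_avoid_subspaces[OF V insert.prems[of p] _ _ \<open>e > 0\<close>] by blast
    have "general_position (dim V) (insert p P) (y(p := z))"
      using y(2) insert.hyps(2) z(3) by (intro general_position_insert) auto
    moreover have "\<forall>q\<in>insert p P. (y(p := z)) q \<in> V \<and> dist ((y(p := z)) q) (x q) < e"
      using y(1) z by simp
    ultimately show ?case by blast
  qed
  then show ?thesis using that by blast
qed

subsection \<open>Nearly isotropic position\<close>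

lemma ex_subset_sum_le_average:
  fixes g :: "'p \<Rightarrow> real"
  assumes "finite A" "k \<le> card A" "k \<ge> 1"
  shows "\<exists>S\<subseteq>A. card S = k \<and> card A * sum g S \<le> k * sum g A"
  using assms(1,2)
proof (induction "card A - k" arbitrary: A)
  case 0
  then show ?case by (intro exI[of _ A]) auto
next
  case (Suc j)
  then have card: "card A \<ge> 2" "A \<noteq> {}" using \<open>k \<ge> 1\<close> by auto
  have "Max (g ` A) \<in> g ` A" using \<open>finite A\<close> card by (intro Max_in) auto
  then obtain a where a: "a \<in> A" "g a = Max (g ` A)" by (metis imageE)
  then have max: "sum g A \<le> card A * g a"
    using \<open>finite A\<close> by (intro sum_bounded_above) auto
  have card_Diff: "card (A - {a}) = card A - 1" using a(1) by simp
  then have "j = card (A - {a}) - k" "k \<le> card (A - {a})" using Suc.hyps(2) by auto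
  then obtain S where S: "S \<subseteq> A - {a}" "card S = k"
    "card (A - {a}) * sum g S \<le> k * sum g (A - {a})"
    using Suc.hyps(1)[of "A - {a}"] \<open>finite A\<close> by auto
  have "(real (card A) - 1) * (card A * sum g S) = card A * (card (A - {a}) * sum g S)"
    using card by (simp add: card_Diff of_nat_diff)
  also have "\<dots> \<le> card A * (k * sum g (A - {a}))"
    using S(3) by (intro mult_left_mono) auto
  also have "\<dots> = k * (card A * sum g A - card A * g a)"
    using a(1) \<open>finite A\<close> by (simp add: sum_diff1 algebra_simps)
  also have "\<dots> \<le> k * ((real (card A) - 1) * sum g A)"
    using max by (intro mult_left_mono) (auto simp: algebra_simps)
  finally have "(real (card A) - 1) * (card A * sum g S) \<le> (real (card A) - 1) * (k * sum g A)"
    by (simp add: mult_ac)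
  then have "card A * sum g S \<le> k * sum g A" using card(1) by simp
  then show ?case using S by blast
qed

lemma near_minimizer:
  fixes f :: "'a \<Rightarrow> real"
  assumes "S \<noteq> {}" and bound: "\<And>x. x \<in> S \<Longrightarrow> c \<le> f x" and "e > 0"
  obtains x where "x \<in> S" "\<And>y. y \<in> S \<Longrightarrow> f x < f y + e"
proof -
  have bdd: "bdd_below (f ` S)" using bound by (rule bdd_belowI2)
  have "Inf (f ` S) < Inf (f ` S) + e" using \<open>e > 0\<close> by simp
  then obtain x where x: "x \<in> S" "f x < Inf (f ` S) + e"
    using cInf_lessD[of "f ` S"] \<open>S \<noteq> {}\<close> by blast
  have "f x < f y + e" if "y \<in> S" for y
    using cInf_lower[OF imageI[OF that] bdd] x(2) by simp
  then show ?thesis using x(1) by (rule that[rotated])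
qed

definition forster_potential :: "nat \<Rightarrow> ('p::finite \<Rightarrow> real^'m) \<Rightarrow> real^'m^'m \<Rightarrow> real" where
  "forster_potential k x B =
    real k * (\<Sum>p\<in>UNIV. ln (norm (B *v x p))) - real CARD('p) * ln \<bar>det B\<bar>"

lemma matrix_vector_mult_nonzero:
  fixes B :: "real^'m^'m"
  assumes "det B \<noteq> 0" "x \<noteq> 0"
  shows "B *v x \<noteq> 0"
  using assms matrix_left_invertible_ker[of B] invertible_det_nz[of B] invertible_left_inverse[of B]
  by metis

lemma abs_det_le_general_position:
  fixes x :: "'p::finite \<Rightarrow> real^'m"
  assumes V: "subspace V" "\<And>p. x p \<in> V" and gen: "general_position (dim V) UNIV x"
    and card: "card S = dim V"
  obtains c where "c > 0"
    "\<And>B. identity_on (V\<^sup>\<bottom>) B \<Longrightarrow> \<bar>det B\<bar> \<le> c * (\<Prod>s\<in>S. norm (B *v x s))"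
proof -
  have S: "inj_on x S" "independent (x ` S)"
    using general_positionD[OF gen, of S] card by auto
  moreover have "x ` S \<subseteq> V" "card (x ` S) = dim V"
    using S(1) V(2) card by (auto simp: card_image)
  ultimately obtain c where "c > 0"
    "\<And>B. identity_on (V\<^sup>\<bottom>) B \<Longrightarrow> \<bar>det B\<bar> \<le> c * (\<Prod>e\<in>x ` S. norm (B *v e))"
    using abs_det_le_subspace_basis[OF V(1)] by blast
  then show ?thesis by (intro that[of c]) (simp_all add: prod.reindex[OF S(1)])
qed

lemma forster_potential_bounded_below:
  fixes x :: "'p::finite \<Rightarrow> real^'m"
  assumes V: "subspace V" "\<And>p. x p \<in> V" and k: "1 \<le> dim V" "dim V \<le> CARD('p)"
    and gen: "general_position (dim V) UNIV x"
  obtains c where "\<And>B. det B \<noteq> 0 \<Longrightarrow> identity_on (V\<^sup>\<bottom>) B \<Longrightarrow> c \<le> forster_potential (dim V) x B"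
proof -
  let ?k = "dim V"
  have nz: "x p \<noteq> 0" for p
    using general_position_nonzero[OF gen _ k(1)] by simp
  have "\<exists>c>0. \<forall>B. identity_on (V\<^sup>\<bottom>) B \<longrightarrow> \<bar>det B\<bar> \<le> c * (\<Prod>s\<in>S. norm (B *v x s))"
    if "card S = ?k" for S
    using abs_det_le_general_position[OF V gen that] by blast
  then obtain c where c: "\<And>S. card S = ?k \<Longrightarrow> c S > 0"
    "\<And>S B. card S = ?k \<Longrightarrow> identity_on (V\<^sup>\<bottom>) B \<Longrightarrow> \<bar>det B\<bar> \<le> c S * (\<Prod>s\<in>S. norm (B *v x s))"
    by metis
  define C where "C = Max ((\<lambda>S. ln (c S)) ` {S. card S = ?k})"
  have "- (real CARD('p) * C) \<le> forster_potential ?k x B"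
    if B: "det B \<noteq> 0" "identity_on (V\<^sup>\<bottom>) B" for B
  proof -
    obtain S where S: "card S = ?k"
      "CARD('p) * (\<Sum>s\<in>S. ln (norm (B *v x s))) \<le> ?k * (\<Sum>p\<in>UNIV. ln (norm (B *v x p)))"
      using ex_subset_sum_le_average[of "UNIV :: 'p set" ?k "\<lambda>p. ln (norm (B *v x p))"] k by auto
    have pos: "norm (B *v x p) > 0" for p
      using matrix_vector_mult_nonzero[OF B(1) nz] by simp
    have "ln \<bar>det B\<bar> \<le> ln (c S * (\<Prod>s\<in>S. norm (B *v x s)))"
      using c(2)[OF S(1) B(2)] B(1) by (intro ln_mono) auto
    also have "\<dots> = ln (c S) + (\<Sum>s\<in>S. ln (norm (B *v x s)))"
      using c(1)[OF S(1)] pos by (simp add: ln_mult_pos prod_pos ln_prod)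
    also have "ln (c S) \<le> C"
      unfolding C_def using S(1) by (intro Max_ge) auto
    finally have "real CARD('p) * ln \<bar>det B\<bar>
        \<le> real CARD('p) * C + real CARD('p) * (\<Sum>s\<in>S. ln (norm (B *v x s)))"
      by (simp flip: distrib_left)
    then show ?thesis using S(2) by (simp add: forster_potential_def)
  qed
  then show ?thesis by (rule that)
qed

lemma forster_potential_near_minimizer:
  fixes x :: "'p::finite \<Rightarrow> real^'m"
  assumes V: "subspace V" "\<And>p. x p \<in> V" and k: "1 \<le> dim V" "dim V \<le> CARD('p)"
    and gen: "general_position (dim V) UNIV x" and "e > 0"
  obtains B where "det B \<noteq> 0" "identity_on (V\<^sup>\<bottom>) B"
    "\<And>B'. det B' \<noteq> 0 \<Longrightarrow> identity_on (V\<^sup>\<bottom>) B' \<Longrightarrow>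
      forster_potential (dim V) x B < forster_potential (dim V) x B' + e"
proof -
  let ?G = "{B :: real^'m^'m. det B \<noteq> 0 \<and> identity_on (V\<^sup>\<bottom>) B}"
  have "mat 1 \<in> ?G" by (simp add: identity_on_def)
  moreover obtain c where
    "\<And>B. det B \<noteq> 0 \<Longrightarrow> identity_on (V\<^sup>\<bottom>) B \<Longrightarrow> c \<le> forster_potential (dim V) x B"
    by (rule forster_potential_bounded_below[OF V k gen]) blast
  then have "\<And>B. B \<in> ?G \<Longrightarrow> c \<le> forster_potential (dim V) x B" by blast
  ultimately obtain B where "B \<in> ?G"
    "\<And>B'. B' \<in> ?G \<Longrightarrow> forster_potential (dim V) x B < forster_potential (dim V) x B' + e"
    using near_minimizer[of ?G c "forster_potential (dim V) x" e] \<open>e > 0\<close> by blast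
  then show ?thesis using that[of B] by blast
qed

lemma ln_norm_rank_one_update_le:
  assumes v: "norm v = 1" and z: "z \<noteq> 0" and t: "t \<ge> 0"
  shows "ln (norm (rank_one_update t v *v z)) \<le> ln (norm z) + (t + t\<^sup>2 / 2) * (v \<bullet> z / norm z)\<^sup>2"
proof -
  let ?y = "rank_one_update t v *v z"
  define e where "e = (2 * t + t\<^sup>2) * (v \<bullet> z / norm z)\<^sup>2"
  have "e \<ge> 0" using t by (simp add: e_def)
  have "(norm ?y)\<^sup>2 = (norm z)\<^sup>2 + (2 * t + t\<^sup>2) * (v \<bullet> z)\<^sup>2"
    using v unfolding rank_one_update_mult power2_norm_eq_inner
    by (simp add: inner_add_left inner_add_right inner_commute norm_eq_1 power2_eq_square
        algebra_simps)
  also have "\<dots> = (norm z)\<^sup>2 * (1 + e)"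
    using z by (simp add: e_def field_simps power_divide)
  finally have norm_sq: "(norm ?y)\<^sup>2 = (norm z)\<^sup>2 * (1 + e)" .
  then have "(norm ?y)\<^sup>2 > 0" using z \<open>e \<ge> 0\<close> by simp
  then have "2 * ln (norm ?y) = ln ((norm z)\<^sup>2 * (1 + e))"
    by (simp add: ln_realpow flip: norm_sq)
  also have "\<dots> = 2 * ln (norm z) + ln (1 + e)"
    using z \<open>e \<ge> 0\<close> by (simp add: ln_mult_pos ln_realpow)
  also have "\<dots> \<le> 2 * ln (norm z) + e"
    using \<open>e \<ge> 0\<close> by (intro add_left_mono ln_add_one_self_le_self)
  finally show ?thesis by (simp add: e_def algebra_simps)
qed

definition sum_square_cos :: "('p::finite \<Rightarrow> 'a::real_inner) \<Rightarrow> 'a \<Rightarrow> real" where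
  "sum_square_cos z v = (\<Sum>p\<in>UNIV. (v \<bullet> z p / norm (z p))\<^sup>2)"

lemma forster_potential_rank_one_update_le:
  fixes x :: "'p::finite \<Rightarrow> real^'m"
  assumes "norm v = 1" "t \<ge> 0" and B: "det B \<noteq> 0" "\<And>p. B *v x p \<noteq> 0"
  shows "forster_potential k x (rank_one_update t v ** B) \<le> forster_potential k x B
    + real k * ((t + t\<^sup>2 / 2) * sum_square_cos (\<lambda>p. B *v x p) v) - real CARD('p) * ln (1 + t)"
proof -
  have "(\<Sum>p\<in>UNIV. ln (norm (rank_one_update t v ** B *v x p)))
      \<le> (\<Sum>p\<in>UNIV. ln (norm (B *v x p)) + (t + t\<^sup>2 / 2) * (v \<bullet> (B *v x p) / norm (B *v x p))\<^sup>2)"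
    unfolding matrix_vector_mul_assoc[symmetric]
    using assms by (intro sum_mono ln_norm_rank_one_update_le) auto
  then have norms: "real k * (\<Sum>p\<in>UNIV. ln (norm (rank_one_update t v ** B *v x p)))
      \<le> real k * (\<Sum>p\<in>UNIV. ln (norm (B *v x p)))
        + real k * ((t + t\<^sup>2 / 2) * sum_square_cos (\<lambda>p. B *v x p) v)"
    by (simp add: sum_square_cos_def sum.distrib mult_left_mono flip: sum_distrib_left distrib_left)
  have "\<bar>det (rank_one_update t v ** B)\<bar> = (1 + t) * \<bar>det B\<bar>"
    using assms by (simp add: det_mul det_rank_one_update abs_mult norm_eq_1)
  then have "ln \<bar>det (rank_one_update t v ** B)\<bar> = ln (1 + t) + ln \<bar>det B\<bar>"
    using assms by (simp add: ln_mult_pos)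
  then show ?thesis
    using norms by (simp add: forster_potential_def algebra_simps)
qed

lemma first_order_share_bound:
  fixes N k s t :: real
  assumes "0 < t" "t < 1" "N \<ge> 0" and less: "N * ln (1 + t) < k * ((t + t\<^sup>2 / 2) * s) + N * t\<^sup>2"
  shows "(1 - 3 * t) * N < k * s"
proof -
  have "N * (t - t\<^sup>2) \<le> N * ln (1 + t)"
    using assms by (intro mult_left_mono ln_one_plus_pos_lower_bound) auto
  with less have "t * (N * (1 - 2 * t)) < t * (k * s * (1 + t / 2))"
    by (simp add: power2_eq_square algebra_simps)
  then have "N * (1 - 2 * t) < k * s * (1 + t / 2)" using \<open>0 < t\<close> by simp
  moreover have "(1 - 3 * t) * N * (1 + t / 2) \<le> N * (1 - 2 * t)"
  proof -
    have "(1 - 3 * t) * (1 + t / 2) \<le> 1 - 2 * t" using \<open>0 < t\<close> by (simp add: algebra_simps)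
    from mult_left_mono[OF this \<open>N \<ge> 0\<close>] show ?thesis by (simp add: mult_ac)
  qed
  ultimately have "(1 - 3 * t) * N * (1 + t / 2) < k * s * (1 + t / 2)" by linarith
  then show ?thesis using \<open>0 < t\<close> by simp
qed

text \<open>A near-minimiser of the scale-invariant potential cannot be improved by stretching along any
  \<open>v \<in> V\<close>, so every direction carries nearly its fair share of the normalised vectors.
  Fixing the complement of \<open>V\<close> makes the ambient determinant play the role of the determinant on
  \<open>V\<close>.\<close>

theorem forster_position:
  fixes x :: "'p::finite \<Rightarrow> real^'m"
  assumes V: "subspace V" "\<And>p. x p \<in> V" and k: "1 \<le> dim V" "dim V \<le> CARD('p)"
    and gen: "general_position (dim V) UNIV x"
    and \<alpha>: "0 < \<alpha>" "\<alpha> < 1"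
  obtains B :: "real^'m^'m" where "det B \<noteq> 0" "identity_on (V\<^sup>\<bottom>) B"
    "\<And>v. v \<in> V \<Longrightarrow> norm v = 1 \<Longrightarrow>
      \<alpha> * (CARD('p) / dim V) \<le> sum_square_cos (\<lambda>p. B *v x p) v"
proof -
  let ?k = "real (dim V)" and ?N = "real CARD('p)" and ?F = "forster_potential (dim V) x"
  define t where "t = (1 - \<alpha>) / 3"
  have t: "0 < t" "t < 1" and \<alpha>_eq: "\<alpha> = 1 - 3 * t"
    using \<alpha> by (simp_all add: t_def field_simps)
  have "?N * t\<^sup>2 > 0" using t by simp
  then obtain B where B: "det B \<noteq> 0" "identity_on (V\<^sup>\<bottom>) B"
    and minimal: "\<And>B'. det B' \<noteq> 0 \<Longrightarrow> identity_on (V\<^sup>\<bottom>) B' \<Longrightarrow> ?F B < ?F B' + ?N * t\<^sup>2"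
    using forster_potential_near_minimizer[OF V k gen] by blast
  show ?thesis
  proof
    show "det B \<noteq> 0" "identity_on (V\<^sup>\<bottom>) B" by (fact B)+
    fix v assume v: "v \<in> V" "norm v = 1"
    let ?s = "sum_square_cos (\<lambda>p. B *v x p) v"
    let ?B = "rank_one_update t v ** B"
    have "v \<bullet> w = 0" if "w \<in> V\<^sup>\<bottom>" for w
      using that v by (auto simp: orthogonal_comp_def orthogonal_def)
    then have "identity_on (V\<^sup>\<bottom>) ?B"
      using B(2) by (simp add: identity_on_def rank_one_update_mult flip: matrix_vector_mul_assoc)
    moreover have "det ?B \<noteq> 0"
      using B(1) t v(2) by (simp add: det_mul det_rank_one_update norm_eq_1)
    ultimately have "?F B < ?F ?B + ?N * t\<^sup>2" by (intro minimal)
    also have "?F ?B \<le> ?F B + ?k * ((t + t\<^sup>2 / 2) * ?s) - ?N * ln (1 + t)"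
      using v(2) t B(1) general_position_nonzero[OF gen _ k(1)]
      by (intro forster_potential_rank_one_update_le matrix_vector_mult_nonzero) auto
    finally have "?N * ln (1 + t) < ?k * ((t + t\<^sup>2 / 2) * ?s) + ?N * t\<^sup>2" by simp
    then have "\<alpha> * ?N < ?k * ?s"
      unfolding \<alpha>_eq using t by (intro first_order_share_bound) auto
    then show "\<alpha> * (?N / ?k) \<le> sum_square_cos (\<lambda>p. B *v x p) v"
      using k(1) by (simp add: field_simps)
  qed
qed

subsection \<open>The sign rank bound\<close>

lemma subspace_inner_representer:
  fixes V :: "'a::euclidean_space set"
  assumes "subspace V"
  obtains y where "y \<in> V" "\<And>x. x \<in> V \<Longrightarrow> x \<bullet> y = x \<bullet> a"
proof -
  obtain y z where "y \<in> span V" "\<And>w. w \<in> span V \<Longrightarrow> orthogonal z w" "a = y + z"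
    using orthogonal_subspace_decomp_exists[of V a] by metis
  moreover have "span V = V" using assms by simp
  ultimately show ?thesis
    by (intro that[of y]) (auto simp: inner_add_right orthogonal_def inner_commute)
qed

lemma sign_pattern_general_position:
  fixes M :: "real^'h^'p"
  assumes nz: "\<And>p h. M $ p $ h \<noteq> 0"
  obtains V :: "(real^'h) set" and x :: "'p \<Rightarrow> real^'h" and y :: "'h \<Rightarrow> real^'h"
  where "subspace V" "dim V = rank M" "\<And>p. x p \<in> V" "\<And>h. y h \<in> V"
    "general_position (rank M) UNIV x" "\<And>p h. sgn (x p \<bullet> y h) = sgn (M $ p $ h)"
proof -
  define V where "V = span (rows M)"
  have V: "subspace V" by (simp add: V_def)
  have dim: "dim V = rank M" by (simp add: V_def row_rank_def)
  have row: "row p M \<in> V" for p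
    unfolding V_def by (rule span_base) (auto simp: rows_def)
  define e where "e = Min (range (\<lambda>(p, h). \<bar>M $ p $ h\<bar>))"
  have "e > 0"
    unfolding e_def using nz by (subst Min_gr_iff) auto
  have e: "e \<le> \<bar>M $ p $ h\<bar>" for p h
    unfolding e_def by (rule Min_le) (auto intro: range_eqI[of _ _ "(p, h)"])
  obtain x where x: "\<And>p. x p \<in> V" "\<And>p. dist (x p) (row p M) < e"
    and gen: "general_position (dim V) UNIV x"
    using perturb_to_general_position[of V UNIV "\<lambda>p. row p M" e] V row \<open>e > 0\<close> by auto
  have "\<exists>y\<in>V. \<forall>x\<in>V. x \<bullet> y = x $ h" for h
    using subspace_inner_representer[OF V, of "axis h 1"] by (metis cart_eq_inner_axis)
  then obtain y where y: "\<And>h. y h \<in> V" "\<And>x h. x \<in> V \<Longrightarrow> x \<bullet> y h = x $ h" by metis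
  have "sgn (x p \<bullet> y h) = sgn (M $ p $ h)" for p h
  proof -
    have "\<bar>x p $ h - M $ p $ h\<bar> \<le> dist (x p) (row p M)"
      using dist_vec_nth_le[of "x p" h "row p M"] by (simp add: row_def dist_real_def)
    then have "\<bar>x p $ h - M $ p $ h\<bar> < \<bar>M $ p $ h\<bar>"
      using x(2)[of p] e[of p h] by linarith
    then show ?thesis
      using y(2)[OF x(1)] by (auto simp: sgn_real_def)
  qed
  then show ?thesis using that[OF V dim x(1) y(1)] gen by (simp add: dim)
qed

lemma contragredient_in_subspace:
  fixes B :: "real^'m^'m"
  assumes V: "subspace V" "y \<in> V" and B: "det B \<noteq> 0" "identity_on (V\<^sup>\<bottom>) B"
  obtains z where "z \<in> V" "\<And>w. z \<bullet> (B *v w) = y \<bullet> w"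
proof -
  obtain B' where B': "B' ** B = mat 1"
    using B(1) by (auto simp: invertible_def simp flip: invertible_det_nz)
  define z where "z = y v* B'"
  have z: "z \<bullet> (B *v w) = y \<bullet> w" for w
    by (simp add: z_def dot_lmul_matrix matrix_vector_mul_assoc B')
  have "w \<bullet> z = 0" if "w \<in> V\<^sup>\<bottom>" for w
  proof -
    have "z \<bullet> w = y \<bullet> w" using z[of w] identity_onD[OF B(2) that] by simp
    also have "\<dots> = 0" using that V(2) by (simp add: orthogonal_comp_def orthogonal_def)
    finally show ?thesis by (simp add: inner_commute)
  qed
  then have "z \<in> V\<^sup>\<bottom>\<^sup>\<bottom>" by (simp add: orthogonal_comp_def[of "V\<^sup>\<bottom>"] orthogonal_def)
  then show ?thesis using that z by (simp add: orthogonal_comp_self[OF V(1)])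
qed

lemma sign_pattern_isotropic_position:
  fixes M :: "real^'h^'p"
  assumes nz: "\<And>p h. M $ p $ h \<noteq> 0" and \<alpha>: "0 < \<alpha>" "\<alpha> < 1"
  obtains u :: "'p \<Rightarrow> real^'h" and v :: "'h \<Rightarrow> real^'h"
  where "\<And>p. norm (u p) = 1" "\<And>h. norm (v h) = 1"
    "\<And>p h. sgn (u p \<bullet> v h) = sgn (M $ p $ h)"
    "\<And>h. \<alpha> * (CARD('p) / rank M) \<le> (\<Sum>p\<in>UNIV. (u p \<bullet> v h)\<^sup>2)"
proof -
  obtain V and x :: "'p \<Rightarrow> real^'h" and y :: "'h \<Rightarrow> real^'h"
    where V: "subspace V" "dim V = rank M" and xV: "\<And>p. x p \<in> V" and yV: "\<And>h. y h \<in> V"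
    and gen: "general_position (rank M) UNIV x"
    and xy: "\<And>p h. sgn (x p \<bullet> y h) = sgn (M $ p $ h)"
    using sign_pattern_general_position[of M] nz by blast
  have "M \<noteq> 0" using nz by (metis zero_index)
  then have k: "1 \<le> dim V" "dim V \<le> CARD('p)"
    using rank_bound[of M] V(2) by (auto simp: Suc_le_eq rank_eq_0 simp flip: neq0_conv)
  obtain B :: "real^'h^'h" where B: "det B \<noteq> 0" "identity_on (V\<^sup>\<bottom>) B"
    and isotropic: "\<And>v. v \<in> V \<Longrightarrow> norm v = 1 \<Longrightarrow>
      \<alpha> * (CARD('p) / dim V) \<le> sum_square_cos (\<lambda>p. B *v x p) v"
    using forster_position[OF V(1) xV k gen[folded V(2)] \<alpha>] by blast
  have "\<exists>z\<in>V. \<forall>w. z \<bullet> (B *v w) = y h \<bullet> w" for h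
    using contragredient_in_subspace[OF V(1) yV B] by metis
  then obtain z where zV: "\<And>h. z h \<in> V" and z: "\<And>h w. z h \<bullet> (B *v w) = y h \<bullet> w" by metis
  define u where "u p = B *v x p /\<^sub>R norm (B *v x p)" for p
  define v where "v h = z h /\<^sub>R norm (z h)" for h
  have sgn_xz: "sgn ((B *v x p) \<bullet> z h) = sgn (M $ p $ h)" for p h
    using xy z by (simp add: inner_commute)
  then have nonzero: "B *v x p \<noteq> 0" "z h \<noteq> 0" for p h
    using nz[of p h] by (metis inner_zero_left inner_zero_right sgn_0 sgn_zero_iff)+
  have v: "norm (v h) = 1" "v h \<in> V" for h
    using nonzero zV V(1) by (simp_all add: v_def subspace_scale)
  show ?thesis
  proof
    show "norm (u p) = 1" for p using nonzero by (simp add: u_def)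
    show "norm (v h) = 1" for h by (rule v)
    show "sgn (u p \<bullet> v h) = sgn (M $ p $ h)" for p h
      using sgn_xz nonzero by (simp add: u_def v_def sgn_mult)
    show "\<alpha> * (CARD('p) / rank M) \<le> (\<Sum>p\<in>UNIV. (u p \<bullet> v h)\<^sup>2)" for h
      using isotropic[OF v(2,1)] V(2)
      by (simp add: sum_square_cos_def u_def inner_commute divide_inverse mult.commute)
  qed
qed

lemma L2_set_norm_components:
  fixes f :: "'i::finite \<Rightarrow> 'a::euclidean_space"
  shows "L2_set (\<lambda>b. norm (\<chi> i. f i \<bullet> b)) Basis = sqrt (\<Sum>i\<in>UNIV. (norm (f i))\<^sup>2)"
proof -
  have "(\<Sum>b\<in>Basis. (norm (\<chi> i. f i \<bullet> b))\<^sup>2) = (\<Sum>b\<in>Basis. \<Sum>i\<in>UNIV. (f i \<bullet> b)\<^sup>2)"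
    unfolding power2_norm_eq_inner by (simp add: inner_vec_def power2_eq_square)
  also have "\<dots> = (\<Sum>i\<in>UNIV. \<Sum>b\<in>Basis. (f i \<bullet> b)\<^sup>2)"
    by (rule sum.swap)
  also have "\<dots> = (\<Sum>i\<in>UNIV. (norm (f i))\<^sup>2)"
    unfolding power2_norm_eq_inner euclidean_inner[of "f _" "f _"] by (simp add: power2_eq_square)
  finally show ?thesis by (simp add: L2_set_def)
qed

lemma sum_matrix_inner_le_onorm:
  fixes W :: "real^'h^'p" and u :: "'p \<Rightarrow> 'a::euclidean_space" and v :: "'h \<Rightarrow> 'a"
  shows "(\<Sum>p\<in>UNIV. \<Sum>h\<in>UNIV. W $ p $ h * (u p \<bullet> v h))
    \<le> onorm ((*v) W) * (sqrt (\<Sum>p\<in>UNIV. (norm (u p))\<^sup>2) * sqrt (\<Sum>h\<in>UNIV. (norm (v h))\<^sup>2))"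
proof -
  define U :: "'a \<Rightarrow> real^'p" where "U b = (\<chi> p. u p \<bullet> b)" for b
  define X :: "'a \<Rightarrow> real^'h" where "X b = (\<chi> h. v h \<bullet> b)" for b
  have "(\<Sum>p\<in>UNIV. \<Sum>h\<in>UNIV. W $ p $ h * (u p \<bullet> v h))
      = (\<Sum>p\<in>UNIV. \<Sum>h\<in>UNIV. \<Sum>b\<in>Basis. W $ p $ h * ((u p \<bullet> b) * (v h \<bullet> b)))"
    by (simp only: euclidean_inner[of "u _" "v _"] sum_distrib_left)
  also have "\<dots> = (\<Sum>p\<in>UNIV. \<Sum>b\<in>Basis. \<Sum>h\<in>UNIV. W $ p $ h * ((u p \<bullet> b) * (v h \<bullet> b)))"
    by (intro sum.cong refl sum.swap)
  also have "\<dots> = (\<Sum>b\<in>Basis. \<Sum>p\<in>UNIV. \<Sum>h\<in>UNIV. W $ p $ h * ((u p \<bullet> b) * (v h \<bullet> b)))"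
    by (rule sum.swap)
  also have "\<dots> = (\<Sum>b\<in>Basis. U b \<bullet> (W *v X b))"
    by (simp add: U_def X_def inner_vec_def matrix_vector_mult_def sum_distrib_left mult_ac)
  also have "\<dots> \<le> (\<Sum>b\<in>Basis. onorm ((*v) W) * (norm (U b) * norm (X b)))"
  proof (rule sum_mono)
    fix b
    have "U b \<bullet> (W *v X b) \<le> norm (U b) * norm (W *v X b)" by (rule norm_cauchy_schwarz)
    also have "\<dots> \<le> norm (U b) * (onorm ((*v) W) * norm (X b))"
      by (intro mult_left_mono onorm) (simp_all add: linear_conv_bounded_linear[symmetric])
    finally show "U b \<bullet> (W *v X b) \<le> onorm ((*v) W) * (norm (U b) * norm (X b))"
      by (simp add: mult_ac)
  qed
  also have "\<dots> = onorm ((*v) W) * (\<Sum>b\<in>Basis. norm (U b) * norm (X b))"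
    by (rule sum_distrib_left[symmetric])
  also have "\<dots> \<le> onorm ((*v) W) * (L2_set (\<lambda>b. norm (U b)) Basis * L2_set (\<lambda>b. norm (X b)) Basis)"
    using L2_set_mult_ineq[of "\<lambda>b. norm (U b)" "\<lambda>b. norm (X b)" Basis]
    by (intro mult_left_mono onorm_pos_le) (simp_all add: linear_conv_bounded_linear[symmetric])
  finally show ?thesis by (simp only: U_def X_def L2_set_norm_components)
qed

lemma scaled_square_le_mult:
  fixes a w \<theta> :: real
  assumes "sgn w = sgn a" "\<bar>a\<bar> \<le> 1" "0 \<le> \<theta>" "\<theta> \<le> \<bar>w\<bar>"
  shows "\<theta> * a\<^sup>2 \<le> w * a"
proof -
  have "a\<^sup>2 \<le> \<bar>a\<bar>"
    using mult_left_mono[of "\<bar>a\<bar>" 1 "\<bar>a\<bar>"] assms(2) by (simp add: power2_eq_square)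
  then have "\<theta> * a\<^sup>2 \<le> \<bar>w\<bar> * \<bar>a\<bar>"
    using assms(3,4) by (intro mult_mono) auto
  also have "\<dots> = w * a"
    using assms(1) by (simp add: sgn_if abs_if split: if_splits)
  finally show ?thesis .
qed

text \<open>Forster's theorem is the case of a sign matrix \<open>W\<close> and \<open>\<theta> = 1\<close>.\<close>

theorem forster_bound:
  fixes M W :: "real^'h^'p" and \<theta> :: real
  assumes nz: "\<And>p h. M $ p $ h \<noteq> 0"
    and sgn: "\<And>p h. sgn (W $ p $ h) = sgn (M $ p $ h)"
    and W: "\<And>p h. \<theta> \<le> \<bar>W $ p $ h\<bar>" and "\<theta> \<ge> 0"
  shows "\<theta> * sqrt (real CARD('p) * real CARD('h)) \<le> rank M * onorm ((*v) W)"
proof -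
  let ?m = "real CARD('p)" and ?n = "real CARD('h)"
  have "M \<noteq> 0" using nz by (metis zero_index)
  then have k: "real (rank M) > 0" by (simp add: rank_eq_0 flip: neq0_conv)
  have approx: "\<alpha> * (\<theta> * ?m * ?n / rank M) \<le> onorm ((*v) W) * sqrt (?m * ?n)"
    if \<alpha>: "0 < \<alpha>" "\<alpha> < 1" for \<alpha>
  proof -
    obtain u :: "'p \<Rightarrow> real^'h" and v :: "'h \<Rightarrow> real^'h"
      where unit: "\<And>p. norm (u p) = 1" "\<And>h. norm (v h) = 1"
        and uv: "\<And>p h. sgn (u p \<bullet> v h) = sgn (M $ p $ h)"
        and isotropic: "\<And>h. \<alpha> * (?m / rank M) \<le> (\<Sum>p\<in>UNIV. (u p \<bullet> v h)\<^sup>2)"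
      using sign_pattern_isotropic_position[OF nz \<alpha>] by blast
    have entry: "\<theta> * (u p \<bullet> v h)\<^sup>2 \<le> W $ p $ h * (u p \<bullet> v h)" for p h
      using Cauchy_Schwarz_ineq2[of "u p" "v h"] W \<open>\<theta> \<ge> 0\<close>
      by (intro scaled_square_le_mult) (simp_all add: sgn uv unit)
    have "\<alpha> * (\<theta> * ?m * ?n / rank M) = (\<Sum>h\<in>(UNIV :: 'h set). \<theta> * (\<alpha> * (?m / rank M)))"
      by simp
    also have "\<dots> \<le> (\<Sum>h\<in>UNIV. \<theta> * (\<Sum>p\<in>UNIV. (u p \<bullet> v h)\<^sup>2))"
      using isotropic \<open>\<theta> \<ge> 0\<close> by (intro sum_mono mult_left_mono)
    also have "\<dots> \<le> (\<Sum>h\<in>UNIV. \<Sum>p\<in>UNIV. W $ p $ h * (u p \<bullet> v h))"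
      unfolding sum_distrib_left by (intro sum_mono entry)
    also have "\<dots> = (\<Sum>p\<in>UNIV. \<Sum>h\<in>UNIV. W $ p $ h * (u p \<bullet> v h))"
      by (rule sum.swap)
    also have "\<dots> \<le> onorm ((*v) W) * sqrt (?m * ?n)"
      using sum_matrix_inner_le_onorm[of W u v] by (simp add: unit real_sqrt_mult)
    finally show ?thesis .
  qed
  have "\<theta> * ?m * ?n / rank M \<le> onorm ((*v) W) * sqrt (?m * ?n)"
    using approx by (rule field_le_mult_one_interval)
  then have "(\<theta> * sqrt (?m * ?n)) * sqrt (?m * ?n) \<le> (rank M * onorm ((*v) W)) * sqrt (?m * ?n)"
    using k by (simp add: field_simps flip: real_sqrt_mult)
  then show ?thesis by simp
qed

section \<open>Sign rank of incidence matrices\<close>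

lemma sign_rank_realization:
  fixes S :: "real^'c^'r"
  assumes "\<And>i j. S $ i $ j \<in> {-1, 1}"
  obtains M :: "real^'c^'r" where "\<And>i j. M $ i $ j \<noteq> 0" "\<And>i j. sgn (M $ i $ j) = S $ i $ j"
    "rank M = sign_rank S"
proof -
  let ?P = "\<lambda>k. \<exists>M :: real^'c^'r.
    (\<forall>i j. M $ i $ j \<noteq> 0) \<and> (\<forall>i j. sgn (M $ i $ j) = S $ i $ j) \<and> rank M = k"
  have "S $ i $ j \<noteq> 0 \<and> sgn (S $ i $ j) = S $ i $ j" for i j
    using assms[of i j] by auto
  then have "?P (rank S)" by blast
  then have "?P (sign_rank S)" unfolding sign_rank_def by (rule LeastI)
  then show ?thesis using that by blast
qed

definition shifted_incidence :: "real \<Rightarrow> ('h::finite \<Rightarrow> 'p::finite set) \<Rightarrow> real^'h^'p" where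
  "shifted_incidence \<theta> blk = (\<chi> p h. (if p \<in> blk h then 1 else 0) - \<theta>)"

lemma shifted_incidence_gram:
  fixes blk :: "'h::finite \<Rightarrow> 'p::finite set"
  assumes r: "\<And>p. card {h. p \<in> blk h} = r"
    and l: "\<And>p q. p \<noteq> q \<Longrightarrow> card {h. p \<in> blk h \<and> q \<in> blk h} = l"
  shows "shifted_incidence \<theta> blk $ p \<bullet> shifted_incidence \<theta> blk $ q
    = (if p = q then real r - real l else 0) + (real l - 2 * \<theta> * real r + \<theta>\<^sup>2 * CARD('h))"
proof -
  have count: "(\<Sum>h\<in>UNIV. if P h then 1 else 0 :: real) = card {h :: 'h. P h}" for P
    by (simp add: sum.If_cases)
  have "shifted_incidence \<theta> blk $ p \<bullet> shifted_incidence \<theta> blk $ q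
      = (\<Sum>h\<in>UNIV. (if p \<in> blk h \<and> q \<in> blk h then 1 else 0)
          - \<theta> * (if p \<in> blk h then 1 else 0) - \<theta> * (if q \<in> blk h then 1 else 0) + \<theta>\<^sup>2)"
    unfolding inner_vec_def
    by (intro sum.cong) (auto simp: shifted_incidence_def power2_eq_square algebra_simps)
  also have "\<dots> = real (card {h. p \<in> blk h \<and> q \<in> blk h}) - 2 * \<theta> * r + \<theta>\<^sup>2 * CARD('h)"
    by (simp add: sum.distrib sum_subtractf count r flip: sum_distrib_left)
  also have "real (card {h. p \<in> blk h \<and> q \<in> blk h}) = (if p = q then real r - real l else 0) + l"
    using r l by simp
  finally show ?thesis by simp
qed

text \<open>The all-ones part of the Gram matrix is non-positive, so it only lowers the norm.\<close>

lemma onorm_shifted_incidence_le: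
  fixes blk :: "'h::finite \<Rightarrow> 'p::finite set"
  assumes r: "\<And>p. card {h. p \<in> blk h} = r"
    and l: "\<And>p q. p \<noteq> q \<Longrightarrow> card {h. p \<in> blk h \<and> q \<in> blk h} = l"
    and \<theta>: "real l - 2 * \<theta> * real r + \<theta>\<^sup>2 * CARD('h) \<le> 0"
  shows "onorm ((*v) (transpose (shifted_incidence \<theta> blk))) \<le> sqrt (real r - real l)"
proof (rule onorm_le)
  fix x :: "real^'p"
  let ?W = "shifted_incidence \<theta> blk" and ?c = "real l - 2 * \<theta> * real r + \<theta>\<^sup>2 * CARD('h)"
  have gram: "?W $ p \<bullet> ?W $ q = (if p = q then real r - real l else 0) + ?c" for p q
    by (rule shifted_incidence_gram[OF r l])
  have "(norm (transpose ?W *v x))\<^sup>2 = (\<Sum>p\<in>UNIV. \<Sum>q\<in>UNIV. x $ p * x $ q * (?W $ p \<bullet> ?W $ q))"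
  proof -
    have "transpose ?W *v x = (\<Sum>p\<in>UNIV. x $ p *\<^sub>R ?W $ p)"
      by (simp add: vec_eq_iff vector_matrix_mult_def mult.commute)
    then show ?thesis
      by (simp only: power2_norm_eq_inner)
        (simp add: inner_sum_left inner_sum_right mult_ac inner_commute sum_distrib_left)
  qed
  also have "\<dots> = (\<Sum>p\<in>UNIV. \<Sum>q\<in>UNIV.
      (if p = q then (real r - real l) * (x $ p)\<^sup>2 else 0) + ?c * (x $ p * x $ q))"
    by (intro sum.cong refl) (simp add: gram power2_eq_square algebra_simps)
  also have "\<dots> = (real r - real l) * (norm x)\<^sup>2 + ?c * (\<Sum>p\<in>UNIV. x $ p)\<^sup>2"
    unfolding power2_norm_eq_inner
    by (simp add: sum.distrib inner_vec_def power2_eq_square sum_product flip: sum_distrib_left)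
  also have "\<dots> \<le> (real r - real l) * (norm x)\<^sup>2"
    using \<theta> by (simp add: mult_nonpos_nonneg)
  finally have "norm (transpose ?W *v x) \<le> sqrt ((real r - real l) * (norm x)\<^sup>2)"
    by (rule real_le_rsqrt)
  then show "norm (transpose ?W *v x) \<le> sqrt (real r - real l) * norm x"
    by (simp add: real_sqrt_mult)
qed

lemma sign_rank_shifted_incidence:
  fixes blk :: "'h::finite \<Rightarrow> 'p::finite set" and \<theta> :: real
  assumes r: "\<And>p. card {h. p \<in> blk h} = r"
    and l: "\<And>p q. p \<noteq> q \<Longrightarrow> card {h. p \<in> blk h \<and> q \<in> blk h} = l"
    and coeff: "real l - 2 * \<theta> * real r + \<theta>\<^sup>2 * CARD('h) \<le> 0"
    and \<theta>: "0 < \<theta>" "\<theta> \<le> 1 / 2"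
  shows "\<theta> * sqrt (real CARD('h) * real CARD('p))
    \<le> sign_rank (signed_incidence blk) * sqrt (real r - real l)"
proof -
  let ?S = "signed_incidence blk" and ?W = "shifted_incidence \<theta> blk"
  have signs: "?S $ p $ h \<in> {-1, 1}" for p h by (simp add: signed_incidence_def)
  obtain M :: "real^'h^'p" where M: "\<And>p h. M $ p $ h \<noteq> 0" "\<And>p h. sgn (M $ p $ h) = ?S $ p $ h"
    "rank M = sign_rank ?S"
    using sign_rank_realization[of ?S] signs by metis
  have "\<theta> * sqrt (real CARD('h) * real CARD('p))
      \<le> rank (transpose M) * onorm ((*v) (transpose ?W))"
  proof (rule forster_bound)
    fix h :: 'h and p :: 'p
    show "transpose M $ h $ p \<noteq> 0" using M(1) by (simp add: transpose_def)
    show "sgn (transpose ?W $ h $ p) = sgn (transpose M $ h $ p)"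
      using \<theta> M(2) by (simp add: transpose_def shifted_incidence_def signed_incidence_def)
    show "\<theta> \<le> \<bar>transpose ?W $ h $ p\<bar>"
      using \<theta> by (simp add: transpose_def shifted_incidence_def)
  qed (use \<theta> in simp)
  also have "\<dots> \<le> sign_rank ?S * sqrt (real r - real l)"
    using onorm_shifted_incidence_le[OF r l coeff] M(3) by (simp add: rank_transpose mult_left_mono)
  finally show ?thesis .
qed

text \<open>The balanced shift \<open>r / CARD('h)\<close> minimises the coefficient of the all-ones matrix;
  \<open>(r + 1) / CARD('h)\<close> still keeps it non-positive and gains the summand \<open>1\<close>.\<close>

theorem sign_rank_design:
  fixes blk :: "'h::finite \<Rightarrow> 'p::finite set"
  assumes r: "\<And>p. card {h. p \<in> blk h} = r"
    and l: "\<And>p q. p \<noteq> q \<Longrightarrow> card {h. p \<in> blk h \<and> q \<in> blk h} = l"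
    and l_less: "l * CARD('h) < r\<^sup>2" and r_le: "2 * (r + 1) \<le> CARD('h)"
  shows "(real r + 1) * sqrt (CARD('p) / CARD('h))
    \<le> sign_rank (signed_incidence blk) * sqrt (real r - real l)"
proof -
  let ?b = "real CARD('h)"
  define \<theta> where "\<theta> = (real r + 1) / ?b"
  have "l * CARD('h) + 1 \<le> r\<^sup>2" using l_less by simp
  then have "real l * ?b + 1 \<le> (real r)\<^sup>2"
    by (metis of_nat_1 of_nat_add of_nat_le_iff of_nat_mult of_nat_power)
  then have "(real l * ?b + 1 - (real r)\<^sup>2) / ?b \<le> 0"
    by (intro divide_nonpos_pos) auto
  also have "(real l * ?b + 1 - (real r)\<^sup>2) / ?b = real l - 2 * \<theta> * real r + \<theta>\<^sup>2 * ?b"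
    by (simp add: \<theta>_def field_simps power2_eq_square)
  finally have coeff: "real l - 2 * \<theta> * real r + \<theta>\<^sup>2 * ?b \<le> 0" .
  have "?b * CARD('p) = ?b\<^sup>2 * (CARD('p) / ?b)" by (simp add: power2_eq_square)
  then have "sqrt (?b * CARD('p)) = ?b * sqrt (CARD('p) / ?b)"
    by (simp only: real_sqrt_mult real_sqrt_abs abs_of_nat)
  then have "(real r + 1) * sqrt (CARD('p) / ?b) = \<theta> * sqrt (?b * CARD('p))"
    by (simp add: \<theta>_def)
  also have "\<dots> \<le> sign_rank (signed_incidence blk) * sqrt (real r - real l)"
    using r_le by (intro sign_rank_shifted_incidence r l coeff) (simp_all add: \<theta>_def field_simps)
  finally show ?thesis .
qed

context finite_projective_space
begin

theorem sign_rank_signed_incidence: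
  fixes hyp :: "'h::finite \<Rightarrow> 'a set"
  assumes hyp: "bij_betw hyp UNIV (hyperplanes lines d)" and "n \<ge> 3"
  shows "real (geom_sum n d) + 1 \<le> sign_rank (signed_incidence hyp) * sqrt (real n ^ (d - 1))"
proof -
  have card_filter: "card {h. P (hyp h)} = card {H \<in> hyperplanes lines d. P H}" for P
  proof (rule bij_betw_same_card[of hyp])
    show "bij_betw hyp {h. P (hyp h)} {H \<in> hyperplanes lines d. P H}"
      using bij_betw_imp_inj_on[OF hyp]
      by (auto simp: bij_betw_def inj_on_def simp flip: bij_betw_imp_surj_on[OF hyp])
  qed
  have square: "(geom_sum n d)\<^sup>2 = geom_sum n (d - 1) * geom_sum n (d + 1) + n ^ (d - 1)"
    and diff: "geom_sum n d = geom_sum n (d - 1) + n ^ (d - 1)"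
    using geom_sum_Suc_square[of n "d - 1"] geom_sum_Suc[of n "d - 1"] dim_pos by simp_all
  have card_h: "CARD('h) = geom_sum n (d + 1)"
    using bij_betw_same_card[OF hyp] card_hyperplanes by simp
  have "(real (geom_sum n d) + 1) * sqrt (CARD('a) / CARD('h))
      \<le> sign_rank (signed_incidence hyp) * sqrt (real (geom_sum n d) - real (geom_sum n (d - 1)))"
  proof (rule sign_rank_design)
    show "card {h. p \<in> hyp h} = geom_sum n d" for p
      using card_filter[of "\<lambda>H. p \<in> H"] card_hyperplanes_point by simp
    show "card {h. p \<in> hyp h \<and> q \<in> hyp h} = geom_sum n (d - 1)" if "p \<noteq> q" for p q
      using card_filter[of "\<lambda>H. p \<in> H \<and> q \<in> H"] card_hyperplanes_two_points[OF that] by simp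
    show "geom_sum n (d - 1) * CARD('h) < (geom_sum n d)\<^sup>2"
      using square order_ge_2 by (simp add: card_h)
    show "2 * (geom_sum n d + 1) \<le> CARD('h)"
      using double_Suc_geom_sum_le[OF \<open>n \<ge> 3\<close> dim_pos] by (simp add: card_h)
  qed
  moreover have "real CARD('a) / CARD('h) = 1"
    using geom_sum_pos[of "d + 1" n] by (simp add: card_points card_h)
  moreover have "real (geom_sum n d) - real (geom_sum n (d - 1)) = real n ^ (d - 1)"
    unfolding diff by simp
  ultimately show ?thesis by simp
qed

end

text \<open>With \<open>D\<close> points on a hyperplane out of \<open>N\<close>, the claim follows from \<open>D\<^sup>2 \<ge> n\<^bsup>d-2\<^esup> N\<close> and
  \<open>N\<^bsup>1/d\<^esup> \<ge> n\<close>.\<close>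

lemma geom_sum_powr_le:
  assumes "d \<ge> 2" "n \<ge> 1"
  shows "real (geom_sum n (d + 1)) powr (1 / 2 - 1 / (2 * real d))
    \<le> geom_sum n d / sqrt (real n ^ (d - 1))"
proof -
  let ?N = "real (geom_sum n (d + 1))" and ?D = "real (geom_sum n d)"
  obtain e where e: "d = Suc (Suc e)"
    using assms(1) by (metis add_2_eq_Suc le_Suc_ex)
  have N: "real n ^ d \<le> ?N" by (simp add: geom_sum_Suc)
  have N_pos: "?N > 0" using geom_sum_pos[of "d + 1" n] by simp
  have "real n = (real n ^ d) powr (1 / d)"
    using assms by (simp add: powr_powr flip: powr_realpow)
  also have "\<dots> \<le> ?N powr (1 / d)"
    using N by (intro powr_mono2) auto
  finally have n_le: "real n \<le> ?N powr (1 / d)" .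
  have "n ^ e * geom_sum n (d + 1) \<le> (geom_sum n d)\<^sup>2"
    using geom_sum_Suc_square[of n "Suc e"] by (simp add: e geom_sum_Suc[of n e] add_mult_distrib)
  then have "real n ^ e * ?N \<le> ?D\<^sup>2"
    by (metis of_nat_le_iff of_nat_mult of_nat_power)
  then have D: "?N / real n \<le> (?D / sqrt (real n ^ (d - 1)))\<^sup>2"
    using assms(2) by (simp add: e field_simps)
  have "?N powr (1 / 2 - 1 / (2 * real d)) = sqrt (?N powr (1 - 1 / d))"
    by (simp add: powr_half_sqrt[symmetric] powr_powr diff_divide_distrib mult.commute)
  also have "\<dots> = sqrt (?N / ?N powr (1 / d))"
    using N_pos by (simp add: powr_diff)
  also have "\<dots> \<le> sqrt (?N / real n)"
    using n_le N_pos assms(2) by (intro real_sqrt_le_mono divide_left_mono) auto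
  also have "\<dots> \<le> ?D / sqrt (real n ^ (d - 1))"
    using D by (intro real_le_lsqrt) auto
  finally show ?thesis .
qed

theorem theorem9:
  fixes lines :: "'p::finite set set"
    and hyp :: "'h::finite \<Rightarrow> 'p set"
    and d n N :: nat
    and A :: "real^'h^'p"
  assumes "d \<ge> 2" and "n \<ge> 3"
    and "projective_space lines"
    and "has_proj_dim lines UNIV d"
    and "has_order lines n"
    and "bij_betw hyp UNIV (hyperplanes lines d)"
    and "A = signed_incidence hyp"
    and "N = (\<Sum>i\<le>d. n ^ i)"
  shows "CARD('p) = N \<and> CARD('h) = N
    \<and> real N = (real n ^ (d + 1) - 1) / (real n - 1)
    \<and> vc_dim A = d
    \<and> real (sign_rank A) > (real n ^ d - 1) / (real n powr ((real d - 1) / 2) * (real n - 1))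
    \<and> (real n ^ d - 1) / (real n powr ((real d - 1) / 2) * (real n - 1))
        \<ge> real N powr (1 / 2 - 1 / (2 * real d))"
proof -
  interpret finite_projective_space lines n d
    using assms by unfold_locales (auto simp: projective_space_def)
  have N: "N = geom_sum n (d + 1)"
    using assms(8) by (simp add: geom_sum_def lessThan_Suc_atMost)
  have n: "real n - 1 > 0" "real n > 0" using assms(2) by auto
  have \<sigma>: "real n powr ((real d - 1) / 2) = sqrt (real n ^ (d - 1))"
    using n assms(1) by (simp add: of_nat_diff powr_powr flip: powr_half_sqrt powr_realpow)
  have bound: "(real n ^ d - 1) / (real n powr ((real d - 1) / 2) * (real n - 1))
      = geom_sum n d / sqrt (real n ^ (d - 1))"
    using n by (simp add: \<sigma> flip: of_nat_geom_sum)
  have "real N = (real n ^ (d + 1) - 1) / (real n - 1)"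
    using n of_nat_geom_sum[of n "d + 1"] by (simp add: N eq_divide_eq)
  moreover have "vc_dim A = d"
    using vc_dim_signed_incidence[of hyp] assms(6,7) by (simp add: bij_betw_def)
  moreover have "geom_sum n d / sqrt (real n ^ (d - 1)) < sign_rank A"
    using sign_rank_signed_incidence[OF assms(6,2)] n by (simp add: assms(7) pos_divide_less_eq)
  moreover have "real N powr (1 / 2 - 1 / (2 * real d)) \<le> geom_sum n d / sqrt (real n ^ (d - 1))"
    unfolding N using assms(1,2) by (intro geom_sum_powr_le) auto
  moreover have "CARD('h) = N"
    using bij_betw_same_card[OF assms(6)] card_hyperplanes N by simp
  ultimately show ?thesis using card_points N unfolding bound by simp
qed

end
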